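(* Let $\Omega$ be a finite set of size $D$ and $x_0\in 2^\Omega$. The actions of $A$ and $B$ on the $\mathcal H$-module $\mathbb C^{2^\Omega}(x_0)$ are given, for all $x\in2^\Omega$, by $$Ax=\left(\frac D4-\frac{|x_0\setminus x|+|x\setminus x_0|}{2}\right)x,\qquad Bx=\left(\frac D2+\frac{(D-2|x|)^2}{4}\right)x+\sum_y y,$$ where the last sum is over all $y\in2^\Omega$ with $|y|=|x|$ and $|x\cap y|=|x|-1$.
   Context: All algebras are unital associative over $\mathbb C$. $U(\mathfrak{sl}_2)$ is generated by $E,F,H$ with $[H,E]=2E$, $[H,F]=-2F$, $[E,F]=H$; $\Lambda=EF+FE+\frac{H^2}{2}$; $\Delta$ is the algebra homomorphism $U(\mathfrak{sl}_2)\to U(\mathfrak{sl}_2)^{\otimes2}$, $\Delta(X)=X\otimes1+1\otimes X$ ($X=E,F,H$). The universal Hahn algebra $\mathcal H$ is generated by $A,B,C$ with $[A,B]=C$ and each of $[C,A]+2A^2+B$, $[B,C]+4BA+2C$ central. $\natural:\mathcal H\to U(\mathfrak{sl}_2)^{\otimes 2}$ is the algebra homomorphism $A\mapsto\frac{H\otimes1-1\otimes H}{4}$, $B\mapsto\frac{\Delta(\Lambda)}2$, $C\mapsto E\otimes F-F\otimes E$; $U(\mathfrak{sl}_2)^{\otimes2}$-modules are $\mathcal H$-modules via $\natural$. For a finite set $S$, $\mathbb C^{2^S}$ has basis $2^S$ and is a $U(\mathfrak{sl}_2)$-module via $Ex=\sum_{y\subseteq x,|y|=|x|-1}y$, $Fx=\sum_{y\supseteq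 x,|y|=|x|+1}y$, $Hx=(|S|-2|x|)x$. Via the linear isomorphism $\iota(x_0):\mathbb C^{2^\Omega}\to\mathbb C^{2^{\Omega\setminus x_0}}\otimes\mathbb C^{2^{x_0}}$, $x\mapsto(x\setminus x_0)\otimes(x\cap x_0)$, $\mathbb C^{2^\Omega}$ becomes a $U(\mathfrak{sl}_2)^{\otimes2}$-module, hence an $\mathcal H$-module, denoted $\mathbb C^{2^\Omega}(x_0)$. *)

theory Defs
  imports Complex_Main "HOL-Library.Poly_Mapping"
begin

section \<open>Complex vector spaces and unital associative complex algebras\<close>

class cvector = ab_group_add +
  fixes scaleC :: "complex \<Rightarrow> 'a \<Rightarrow> 'a"  (infixr \<open>*\<^sub>C\<close> 75)
  assumes scaleC_add_right: "c *\<^sub>C (x + y) = c *\<^sub>C x + c *\<^sub>C y"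
    and scaleC_add_left: "(c + d) *\<^sub>C x = c *\<^sub>C x + d *\<^sub>C x"
    and scaleC_scaleC [simp]: "c *\<^sub>C (d *\<^sub>C x) = (c * d) *\<^sub>C x"
    and scaleC_one [simp]: "1 *\<^sub>C x = x"

class calgebra = cvector + ring + monoid_mult +
  assumes mult_scaleC_left [simp]: "(c *\<^sub>C x) * y = c *\<^sub>C (x * y)"
    and mult_scaleC_right [simp]: "x * (c *\<^sub>C y) = c *\<^sub>C (x * y)"

definition clinear :: "('v::cvector \<Rightarrow> 'w::cvector) \<Rightarrow> bool"
  where "clinear f \<longleftrightarrow> (\<forall>x y. f (x + y) = f x + f y) \<and> (\<forall>c x. f (c *\<^sub>C x) = c *\<^sub>C f x)"

definition algebra_hom :: "('a::calgebra \<Rightarrow> 'b::calgebra) \<Rightarrow> bool"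
  where "algebra_hom f \<longleftrightarrow> clinear f \<and> f 1 = 1 \<and> (\<forall>x y. f (x * y) = f x * f y)"

lemma scaleC_zero_left [simp]: "0 *\<^sub>C x = (0::'a::cvector)"
  using scaleC_add_left[of 0 0 x] by simp

lemma scaleC_zero_right [simp]: "c *\<^sub>C 0 = (0::'a::cvector)"
  using scaleC_add_right[of c 0 0] by simp

lemma scaleC_minus_left [simp]: "(- c) *\<^sub>C x = - (c *\<^sub>C (x::'a::cvector))"
  using scaleC_add_left[of "-c" c x] by (simp add: eq_neg_iff_add_eq_0)

lemma scaleC_minus_right [simp]: "c *\<^sub>C (- x) = - (c *\<^sub>C (x::'a::cvector))"
  using scaleC_add_right[of c "-x" x] by (simp add: eq_neg_iff_add_eq_0)

lemma scaleC_diff_right: "c *\<^sub>C (x - y) = c *\<^sub>C x - c *\<^sub>C (y::'a::cvector)"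
  using scaleC_add_right[of c x "-y"] by simp

lemma scaleC_diff_left: "(c - d) *\<^sub>C x = c *\<^sub>C x - d *\<^sub>C (x::'a::cvector)"
  using scaleC_add_left[of c "-d" x] by simp

lemma scaleC_sum_right: "c *\<^sub>C (\<Sum>i\<in>I. f i) = (\<Sum>i\<in>I. c *\<^sub>C (f i :: 'a::cvector))"
  by (induction I rule: infinite_finite_induct) (auto simp: scaleC_add_right)

lemma scaleC_sum_left: "(\<Sum>i\<in>I. f i) *\<^sub>C x = (\<Sum>i\<in>I. f i *\<^sub>C (x :: 'a::cvector))"
  by (induction I rule: infinite_finite_induct) (auto simp: scaleC_add_left)

lemma scaleC_eqD:
  fixes x y :: "'a::cvector"
  assumes "c *\<^sub>C x = c *\<^sub>C y" "c \<noteq> 0"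
  shows "x = y"
proof -
  have "inverse c *\<^sub>C (c *\<^sub>C x) = inverse c *\<^sub>C (c *\<^sub>C y)" by (simp only: assms(1))
  then show ?thesis using assms(2) by simp
qed

lemma clinearI:
  assumes "\<And>x y. f (x + y) = f x + f y" "\<And>c x. f (c *\<^sub>C x) = c *\<^sub>C f x"
  shows "clinear f"
  using assms by (simp add: clinear_def)

lemma clinear_add: "clinear f \<Longrightarrow> f (x + y) = f x + f y"
  by (simp add: clinear_def)

lemma clinear_scaleC: "clinear f \<Longrightarrow> f (c *\<^sub>C x) = c *\<^sub>C f x"
  by (simp add: clinear_def)

lemma clinear_zero: "clinear f \<Longrightarrow> f 0 = 0"
  using clinear_scaleC[of f 0 0] by simp

lemma clinear_uminus: "clinear f \<Longrightarrow> f (- x) = - f x"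
  using clinear_scaleC[of f "-1" x] by simp

lemma clinear_diff: "clinear f \<Longrightarrow> f (x - y) = f x - f y"
  using clinear_add[of f x "- y"] by (simp add: clinear_uminus)

lemma clinear_sum: "clinear f \<Longrightarrow> f (\<Sum>i\<in>I. g i) = (\<Sum>i\<in>I. f (g i))"
  by (induction I rule: infinite_finite_induct) (auto simp: clinear_zero clinear_add)

lemma clinear_id: "clinear (\<lambda>x. x)"
  by (simp add: clinear_def)

lemma clinear_compose: "clinear f \<Longrightarrow> clinear g \<Longrightarrow> clinear (\<lambda>x. f (g x))"
  by (simp add: clinear_def)

lemma algebra_hom_clinear: "algebra_hom f \<Longrightarrow> clinear f"
  by (simp add: algebra_hom_def)

lemma algebra_hom_one: "algebra_hom f \<Longrightarrow> f 1 = 1"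
  by (simp add: algebra_hom_def)

lemma algebra_hom_mult: "algebra_hom f \<Longrightarrow> f (x * y) = f x * f y"
  by (simp add: algebra_hom_def)

lemmas algebra_hom_simps =
  algebra_hom_one algebra_hom_mult clinear_add[OF algebra_hom_clinear]
  clinear_diff[OF algebra_hom_clinear] clinear_uminus[OF algebra_hom_clinear]
  clinear_zero[OF algebra_hom_clinear] clinear_scaleC[OF algebra_hom_clinear]

instantiation complex :: calgebra
begin
definition scaleC_complex :: "complex \<Rightarrow> complex \<Rightarrow> complex" where "scaleC_complex = (*)"
instance by standard (simp_all add: scaleC_complex_def algebra_simps)
end

subsection \<open>Free vector spaces\<close>

instantiation poly_mapping :: (type, cvector) cvector
begin

definition scaleC_poly_mapping :: "complex \<Rightarrow> ('a \<Rightarrow>\<^sub>0 'b) \<Rightarrow> ('a \<Rightarrow>\<^sub>0 'b)"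
  where "scaleC_poly_mapping c p = Poly_Mapping.map (\<lambda>z. c *\<^sub>C z) p"

lemma lookup_scaleC [simp]:
  "Poly_Mapping.lookup (c *\<^sub>C p) k = c *\<^sub>C (Poly_Mapping.lookup p k :: 'b)"
  by (simp add: scaleC_poly_mapping_def Poly_Mapping.map.rep_eq when_def)

instance
  by standard (auto intro!: poly_mapping_eqI simp: lookup_add scaleC_add_right scaleC_add_left)

end

text \<open>The basis vector \<open>k\<close> of the free vector space on a type.\<close>

abbreviation vec :: "'k \<Rightarrow> 'k \<Rightarrow>\<^sub>0 complex"
  where "vec k \<equiv> Poly_Mapping.single k 1"

definition lin_ext :: "('k \<Rightarrow> 'v::cvector) \<Rightarrow> ('k \<Rightarrow>\<^sub>0 complex) \<Rightarrow> 'v"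
  where "lin_ext f p = (\<Sum>k\<in>Poly_Mapping.keys p. Poly_Mapping.lookup p k *\<^sub>C f k)"

lemma single_eq_scaleC: "Poly_Mapping.single k c = c *\<^sub>C vec k"
  by (rule poly_mapping_eqI) (simp add: lookup_single scaleC_complex_def when_def)

lemma lin_ext_superset:
  assumes "finite K" "Poly_Mapping.keys p \<subseteq> K"
  shows "lin_ext f p = (\<Sum>k\<in>K. Poly_Mapping.lookup p k *\<^sub>C f k)"
  unfolding lin_ext_def
  by (rule sum.mono_neutral_left[OF assms]) (auto simp: in_keys_iff)

lemma clinear_lin_ext: "clinear (lin_ext f)"
proof (rule clinearI)
  fix p q :: "'a \<Rightarrow>\<^sub>0 complex"
  let ?K = "Poly_Mapping.keys p \<union> Poly_Mapping.keys q"
  have "Poly_Mapping.keys (p + q) \<subseteq> ?K" by (rule keys_add)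
  then show "lin_ext f (p + q) = lin_ext f p + lin_ext f q"
    by (simp add: lin_ext_superset[of ?K] lookup_add scaleC_add_left sum.distrib)
next
  fix c and p :: "'a \<Rightarrow>\<^sub>0 complex"
  have "Poly_Mapping.keys (c *\<^sub>C p) \<subseteq> Poly_Mapping.keys p"
    by (auto simp: in_keys_iff)
  then show "lin_ext f (c *\<^sub>C p) = c *\<^sub>C lin_ext f p"
    by (simp add: lin_ext_superset[of "Poly_Mapping.keys p"] scaleC_sum_right scaleC_complex_def)
qed

lemma lin_ext_vec [simp]: "lin_ext f (vec k) = f k"
  by (simp add: lin_ext_def)

lemma poly_mapping_vec_expansion:
  "(p :: 'k \<Rightarrow>\<^sub>0 complex) = (\<Sum>k\<in>Poly_Mapping.keys p. Poly_Mapping.lookup p k *\<^sub>C vec k)"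
proof (rule poly_mapping_eqI)
  fix i
  show "Poly_Mapping.lookup p i
      = Poly_Mapping.lookup (\<Sum>k\<in>Poly_Mapping.keys p. Poly_Mapping.lookup p k *\<^sub>C vec k) i"
    by (cases "i \<in> Poly_Mapping.keys p")
      (auto simp: lookup_sum lookup_single scaleC_complex_def when_def if_distrib in_keys_iff
        cong: if_cong intro!: sum.neutral)
qed

lemma vec_induct [case_names zero vec add scale]:
  fixes p :: "'k \<Rightarrow>\<^sub>0 complex"
  assumes zero: "P 0" and vec: "\<And>k. k \<in> Poly_Mapping.keys p \<Longrightarrow> P (vec k)"
    and add: "\<And>p q. P p \<Longrightarrow> P q \<Longrightarrow> P (p + q)" and scale: "\<And>c p. P p \<Longrightarrow> P (c *\<^sub>C p)"
  shows "P p"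
proof -
  have "K \<subseteq> Poly_Mapping.keys p \<Longrightarrow> P (\<Sum>k\<in>K. Poly_Mapping.lookup p k *\<^sub>C vec k)" for K
    by (induction K rule: infinite_finite_induct) (auto intro: assms)
  then show ?thesis
    by (subst poly_mapping_vec_expansion) blast
qed

lemma clinear_eq_on_vec:
  assumes "clinear f" "clinear g" "\<And>k. k \<in> Poly_Mapping.keys p \<Longrightarrow> f (vec k) = g (vec k)"
  shows "f p = g p"
  by (rule vec_induct[of "\<lambda>q. f q = g q" p])
    (auto simp: clinear_zero clinear_add clinear_scaleC assms)

subsection \<open>Endomorphism algebras\<close>

typedef (overloaded) 'v lin = "{f :: 'v::cvector \<Rightarrow> 'v. clinear f}"
  morphisms app Abs_lin
  using clinear_id by blast

setup_lifting type_definition_lin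

lemma clinear_app: "clinear (app f)"
  using app by blast

lemma app_Abs_lin: "clinear f \<Longrightarrow> app (Abs_lin f) = f"
  by (simp add: Abs_lin_inverse)

instantiation lin :: (cvector) calgebra
begin

lift_definition zero_lin :: "'a lin" is "\<lambda>v. 0" by (simp add: clinear_def)
lift_definition one_lin :: "'a lin" is "\<lambda>v. v" by (simp add: clinear_def)
lift_definition plus_lin :: "'a lin \<Rightarrow> 'a lin \<Rightarrow> 'a lin" is "\<lambda>f g v. f v + g v"
  by (simp add: clinear_def scaleC_add_right)
lift_definition minus_lin :: "'a lin \<Rightarrow> 'a lin \<Rightarrow> 'a lin" is "\<lambda>f g v. f v - g v"
  by (simp add: clinear_def scaleC_diff_right)
lift_definition uminus_lin :: "'a lin \<Rightarrow> 'a lin" is "\<lambda>f v. - f v"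
  by (simp add: clinear_def)
lift_definition times_lin :: "'a lin \<Rightarrow> 'a lin \<Rightarrow> 'a lin" is "\<lambda>f g v. f (g v)"
  by (simp add: clinear_def)
lift_definition scaleC_lin :: "complex \<Rightarrow> 'a lin \<Rightarrow> 'a lin" is "\<lambda>c f v. c *\<^sub>C f v"
  by (simp add: clinear_def scaleC_add_right mult.commute)

instance
  by standard
    (transfer, auto simp: clinear_add clinear_scaleC scaleC_add_right scaleC_add_left fun_eq_iff)+

end

lemmas app_simps [simp] =
  zero_lin.rep_eq one_lin.rep_eq plus_lin.rep_eq minus_lin.rep_eq uminus_lin.rep_eq
  times_lin.rep_eq scaleC_lin.rep_eq

lemma lin_eqI: "(\<And>v. app f v = app g v) \<Longrightarrow> f = g"
  by (simp add: app_inject[symmetric] fun_eq_iff)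

subsection \<open>Tensor products\<close>

inductive_set tensor_null :: "('v::cvector \<times> 'w::cvector \<Rightarrow>\<^sub>0 complex) set" where
  zero: "0 \<in> tensor_null"
| add_left: "vec (v + v', w) - vec (v, w) - vec (v', w) \<in> tensor_null"
| add_right: "vec (v, w + w') - vec (v, w) - vec (v, w') \<in> tensor_null"
| scale_left: "vec (c *\<^sub>C v, w) - c *\<^sub>C vec (v, w) \<in> tensor_null"
| scale_right: "vec (v, c *\<^sub>C w) - c *\<^sub>C vec (v, w) \<in> tensor_null"
| plus: "p \<in> tensor_null \<Longrightarrow> q \<in> tensor_null \<Longrightarrow> p + q \<in> tensor_null"
| scale: "p \<in> tensor_null \<Longrightarrow> c *\<^sub>C p \<in> tensor_null"

lemma tensor_null_uminus: "p \<in> tensor_null \<Longrightarrow> - p \<in> tensor_null"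
  using tensor_null.scale[of p "-1"] by simp

lemma tensor_null_diff: "p \<in> tensor_null \<Longrightarrow> q \<in> tensor_null \<Longrightarrow> p - q \<in> tensor_null"
  using tensor_null.plus[OF _ tensor_null_uminus, of p q] by simp

quotient_type (overloaded) ('v, 'w) tensor = "('v::cvector \<times> 'w::cvector) \<Rightarrow>\<^sub>0 complex"
  / "\<lambda>p q. p - q \<in> tensor_null"
proof (rule equivpI)
  show "reflp (\<lambda>p q. p - q \<in> (tensor_null :: ('v \<times> 'w \<Rightarrow>\<^sub>0 complex) set))"
    by (simp add: reflp_def tensor_null.zero)
  show "symp (\<lambda>p q. p - q \<in> (tensor_null :: ('v \<times> 'w \<Rightarrow>\<^sub>0 complex) set))"
    using tensor_null_uminus by (force simp: symp_def)
  show "transp (\<lambda>p q. p - q \<in> (tensor_null :: ('v \<times> 'w \<Rightarrow>\<^sub>0 complex) set))"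
    using tensor_null.plus by (force simp: transp_def)
qed

instantiation tensor :: (cvector, cvector) cvector
begin

lift_definition zero_tensor :: "('a, 'b) tensor" is 0 .
lift_definition plus_tensor :: "('a, 'b) tensor \<Rightarrow> ('a, 'b) tensor \<Rightarrow> ('a, 'b) tensor" is "(+)"
  by (subst add_diff_add) (rule tensor_null.plus)
lift_definition uminus_tensor :: "('a, 'b) tensor \<Rightarrow> ('a, 'b) tensor" is uminus
  using tensor_null_uminus by force
lift_definition minus_tensor :: "('a, 'b) tensor \<Rightarrow> ('a, 'b) tensor \<Rightarrow> ('a, 'b) tensor" is "(-)"
proof -
  fix p p' q q' :: "'a \<times> 'b \<Rightarrow>\<^sub>0 complex"
  assume "p - p' \<in> tensor_null" "q - q' \<in> tensor_null"
  then have "(p - p') - (q - q') \<in> tensor_null" by (rule tensor_null_diff)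
  then show "p - q - (p' - q') \<in> tensor_null" by (simp add: algebra_simps)
qed
lift_definition scaleC_tensor :: "complex \<Rightarrow> ('a, 'b) tensor \<Rightarrow> ('a, 'b) tensor" is "(*\<^sub>C)"
  by (simp add: tensor_null.scale flip: scaleC_diff_right)

instance
proof
  fix a b c :: "('a, 'b) tensor" and x y
  show "a + b + c = a + (b + c)"
    by transfer (simp add: add.assoc tensor_null.zero)
  show "a + b = b + a"
    by transfer (simp add: add.commute tensor_null.zero)
  show "0 + a = a" "- a + a = 0" "a - b = a + - b" "1 *\<^sub>C a = a" "x *\<^sub>C (y *\<^sub>C a) = (x * y) *\<^sub>C a"
    by (transfer, simp add: tensor_null.zero)+
  show "x *\<^sub>C (a + b) = x *\<^sub>C a + x *\<^sub>C b" "(x + y) *\<^sub>C a = x *\<^sub>C a + y *\<^sub>C a"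
    by (transfer, simp add: tensor_null.zero scaleC_add_right scaleC_add_left)+
qed

end

lift_definition tens :: "'v::cvector \<Rightarrow> 'w::cvector \<Rightarrow> ('v, 'w) tensor"  (infixr \<open>\<otimes>\<close> 72)
  is "\<lambda>v w. vec (v, w)" .

lemma tens_add_left: "(v + v') \<otimes> w = v \<otimes> w + v' \<otimes> w"
  by transfer (use tensor_null.add_left in \<open>simp add: diff_diff_eq\<close>)

lemma tens_add_right: "v \<otimes> (w + w') = v \<otimes> w + v \<otimes> w'"
  by transfer (use tensor_null.add_right in \<open>simp add: diff_diff_eq\<close>)

lemma tens_scaleC_left: "(c *\<^sub>C v) \<otimes> w = c *\<^sub>C (v \<otimes> w)"
  by transfer (rule tensor_null.scale_left)

lemma tens_scaleC_right: "v \<otimes> (c *\<^sub>C w) = c *\<^sub>C (v \<otimes> w)"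
  by transfer (rule tensor_null.scale_right)

definition cbilinear :: "('v::cvector \<Rightarrow> 'w::cvector \<Rightarrow> 'u::cvector) \<Rightarrow> bool"
  where "cbilinear f \<longleftrightarrow> (\<forall>w. clinear (\<lambda>v. f v w)) \<and> (\<forall>v. clinear (f v))"

lemma cbilinearI: "(\<And>w. clinear (\<lambda>v. f v w)) \<Longrightarrow> (\<And>v. clinear (f v)) \<Longrightarrow> cbilinear f"
  by (simp add: cbilinear_def)

lemma cbilinear_tens: "cbilinear (\<otimes>)"
  by (simp add: cbilinear_def clinear_def tens_add_left tens_add_right tens_scaleC_left tens_scaleC_right)

text \<open>For bilinear \<open>f\<close> this is the linear map with \<open>v \<otimes> w \<mapsto> f v w\<close>, see \<open>tensor_lift_tens\<close>
  and \<open>clinear_tensor_lift\<close>; it is not meaningful for other \<open>f\<close>.\<close>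

definition tensor_lift :: "('v::cvector \<Rightarrow> 'w::cvector \<Rightarrow> 'u::cvector) \<Rightarrow> ('v, 'w) tensor \<Rightarrow> 'u"
  where "tensor_lift f t = lin_ext (\<lambda>(v, w). f v w) (rep_tensor t)"

lemma tensor_lift_abs:
  assumes f: "cbilinear f"
  shows "tensor_lift f (abs_tensor p) = lin_ext (\<lambda>(v, w). f v w) p"
proof -
  let ?L = "lin_ext (\<lambda>(v, w). f v w)"
  have lin: "clinear ?L" by (rule clinear_lin_ext)
  have fl: "clinear (\<lambda>v. f v w)" and fr: "clinear (f v)" for v w
    using f by (auto simp: cbilinear_def)
  have null: "?L q = 0" if "q \<in> tensor_null" for q
    using that
    by induction (auto simp: clinear_zero[OF lin] clinear_add[OF lin] clinear_diff[OF lin]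
        clinear_scaleC[OF lin] clinear_add[OF fl] clinear_add[OF fr] clinear_scaleC[OF fl]
        clinear_scaleC[OF fr])
  have "rep_tensor (abs_tensor p) - p \<in> tensor_null"
    using Quotient3_tensor by (rule rep_abs_rsp_left) (simp add: tensor_null.zero)
  from null[OF this] show ?thesis
    by (simp add: tensor_lift_def clinear_diff[OF lin])
qed

lemma tensor_lift_tens: "cbilinear f \<Longrightarrow> tensor_lift f (v \<otimes> w) = f v w"
  by (simp add: tens.abs_eq tensor_lift_abs)

lemma clinear_tensor_lift:
  assumes f: "cbilinear f"
  shows "clinear (tensor_lift f)"
proof (rule clinearI)
  have lin: "clinear (lin_ext (\<lambda>(v, w). f v w))" by (rule clinear_lin_ext)
  show "tensor_lift f (s + t) = tensor_lift f s + tensor_lift f t" for s t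
    by (induct s, induct t) (simp add: plus_tensor.abs_eq tensor_lift_abs f clinear_add[OF lin])
  show "tensor_lift f (c *\<^sub>C t) = c *\<^sub>C tensor_lift f t" for c t
    by (induct t) (simp add: scaleC_tensor.abs_eq tensor_lift_abs f clinear_scaleC[OF lin])
qed

lemma tensor_induct [case_names tens add]:
  assumes tens: "\<And>v w. P (v \<otimes> w)" and add: "\<And>s t. P s \<Longrightarrow> P t \<Longrightarrow> P (s + t)"
  shows "P t"
proof (induct t)
  fix p :: "'a \<times> 'b \<Rightarrow>\<^sub>0 complex"
  have lin: "clinear (abs_tensor :: ('a \<times> 'b \<Rightarrow>\<^sub>0 complex) \<Rightarrow> _)"
    by (rule clinearI) (simp_all add: plus_tensor.abs_eq scaleC_tensor.abs_eq)
  have zero: "P 0" using tens[of 0 0] tens_scaleC_left[of 0 "0::'a" "0::'b"] by simp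
  have "P (\<Sum>k\<in>K. Poly_Mapping.lookup p k *\<^sub>C abs_tensor (vec k))" for K
  proof (induction K rule: infinite_finite_induct)
    case (insert k K)
    obtain v w where "k = (v, w)" by (cases k)
    then have "P (Poly_Mapping.lookup p k *\<^sub>C abs_tensor (vec k))"
      using tens[of "Poly_Mapping.lookup p k *\<^sub>C v" w]
      by (simp add: tens_scaleC_left tens.abs_eq[of v])
    then show ?case using insert by (simp add: add)
  qed (auto simp: zero)
  then have "P (abs_tensor (\<Sum>k\<in>Poly_Mapping.keys p. Poly_Mapping.lookup p k *\<^sub>C vec k))"
    by (simp add: clinear_sum[OF lin] clinear_scaleC[OF lin])
  then show "P (abs_tensor p)" by (simp flip: poly_mapping_vec_expansion)
qed

lemma clinear_eq_on_tens:
  assumes "clinear f" "clinear g" "\<And>v w. f (v \<otimes> w) = g (v \<otimes> w)"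
  shows "f t = g t"
  by (induction t rule: tensor_induct) (simp_all add: assms clinear_add)

lemma clinear_tensor_lift_param:
  assumes "\<And>x. cbilinear (f x)" "\<And>v w. clinear (\<lambda>x. f x v w)"
  shows "clinear (\<lambda>x. tensor_lift (f x) t)"
proof (induction t rule: tensor_induct)
  case (tens v w)
  then show ?case by (simp add: tensor_lift_tens assms)
next
  case (add s t)
  then show ?case
    by (simp add: clinear_add[OF clinear_tensor_lift[OF assms(1)]] clinear_def scaleC_add_right algebra_simps)
qed

text \<open>The multiplication of \<open>A \<otimes> B\<close> is determined by \<open>(a \<otimes> b) (a' \<otimes> b') = a a' \<otimes> b b'\<close>.\<close>

instantiation tensor :: (calgebra, calgebra) calgebra
begin

definition one_tensor :: "('a, 'b) tensor" where "one_tensor = 1 \<otimes> 1"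

definition times_tensor :: "('a, 'b) tensor \<Rightarrow> ('a, 'b) tensor \<Rightarrow> ('a, 'b) tensor"
  where "times_tensor s t =
    tensor_lift (\<lambda>a b. tensor_lift (\<lambda>a' b'. (a * a') \<otimes> (b * b')) t) s"

lemma cbilinear_times_inner: "cbilinear (\<lambda>a' b'. ((a::'a) * a') \<otimes> ((b::'b) * b'))"
  by (auto simp: cbilinear_def clinear_def tens_add_left tens_add_right tens_scaleC_left
      tens_scaleC_right distrib_left)

lemma cbilinear_times_outer:
  "cbilinear (\<lambda>a b. tensor_lift (\<lambda>a' b'. ((a::'a) * a') \<otimes> ((b::'b) * b')) t)"
  by (rule cbilinearI; rule clinear_tensor_lift_param[OF cbilinear_times_inner])
    (auto simp: clinear_def tens_add_left tens_add_right tens_scaleC_left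
      tens_scaleC_right distrib_right)

lemma tens_mult [simp]: "((a::'a) \<otimes> (b::'b)) * (a' \<otimes> b') = (a * a') \<otimes> (b * b')"
  unfolding times_tensor_def
  by (rule trans[OF tensor_lift_tens[OF cbilinear_times_outer] tensor_lift_tens[OF cbilinear_times_inner]])

lemma tensor_mult_linear_left: "clinear (\<lambda>s. s * (t :: ('a, 'b) tensor))"
  unfolding times_tensor_def by (rule clinear_tensor_lift[OF cbilinear_times_outer])

lemma tensor_mult_linear_right: "clinear (\<lambda>t. s * (t :: ('a, 'b) tensor))"
proof (induction s rule: tensor_induct)
  case (tens a b)
  have "(\<lambda>t. (a \<otimes> b) * t) = tensor_lift (\<lambda>a' b'. (a * a') \<otimes> (b * b'))"
    unfolding times_tensor_def by (rule ext) (rule tensor_lift_tens[OF cbilinear_times_outer])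
  then show ?case by (simp only: clinear_tensor_lift[OF cbilinear_times_inner])
next
  case (add s t)
  then show ?case
    by (simp add: clinear_add[OF tensor_mult_linear_left] clinear_def scaleC_add_right algebra_simps)
qed

instance
proof
  fix r s t :: "('a, 'b) tensor" and c
  show dr: "(r + s) * t = r * t + s * t" for r s t :: "('a, 'b) tensor"
    by (rule clinear_add[OF tensor_mult_linear_left])
  show dl: "r * (s + t) = r * s + r * t" for r s t :: "('a, 'b) tensor"
    by (rule clinear_add[OF tensor_mult_linear_right])
  show "c *\<^sub>C s * t = c *\<^sub>C (s * t)" "s * c *\<^sub>C t = c *\<^sub>C (s * t)"
    by (rule clinear_scaleC[OF tensor_mult_linear_left], rule clinear_scaleC[OF tensor_mult_linear_right])
  show "1 * t = t" "t * 1 = t"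
    by (induction t rule: tensor_induct) (simp_all add: dr dl one_tensor_def)
  have 1: "((a \<otimes> b) * (a' \<otimes> b')) * t = (a \<otimes> b) * ((a' \<otimes> b') * t)" for a a' :: 'a and b b' :: 'b
    by (induction t rule: tensor_induct) (simp_all add: dl mult.assoc)
  have 2: "((a \<otimes> b) * s) * t = (a \<otimes> b) * (s * t)" for a :: 'a and b :: 'b
    by (induction s rule: tensor_induct) (simp_all add: dl dr 1 del: tens_mult)
  show "r * s * t = r * (s * t)"
    by (induction r rule: tensor_induct) (simp_all add: dr 2)
qed

end

text \<open>\<open>V \<otimes> W\<close> for subspaces \<open>V\<close>, \<open>W\<close>, as a subspace of the tensor product of the ambient spaces.\<close>

inductive_set tensor_space :: "'v::cvector set \<Rightarrow> 'w::cvector set \<Rightarrow> ('v, 'w) tensor set"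
  for V W where
  tens: "v \<in> V \<Longrightarrow> w \<in> W \<Longrightarrow> v \<otimes> w \<in> tensor_space V W"
| add: "s \<in> tensor_space V W \<Longrightarrow> t \<in> tensor_space V W \<Longrightarrow> s + t \<in> tensor_space V W"

definition tensor_map :: "'v::cvector lin \<Rightarrow> 'w::cvector lin \<Rightarrow> ('v, 'w) tensor lin"
  where "tensor_map f g = Abs_lin (tensor_lift (\<lambda>v w. app f v \<otimes> app g w))"

lemma cbilinear_tensor_map: "cbilinear (\<lambda>v w. app f v \<otimes> app g w)"
  by (auto simp: cbilinear_def clinear_def clinear_add[OF clinear_app] clinear_scaleC[OF clinear_app]
      tens_add_left tens_add_right tens_scaleC_left tens_scaleC_right)

lemma app_tensor_map: "app (tensor_map f g) = tensor_lift (\<lambda>v w. app f v \<otimes> app g w)"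
  by (simp add: tensor_map_def app_Abs_lin clinear_tensor_lift cbilinear_tensor_map)

lemma app_tensor_map_tens [simp]: "app (tensor_map f g) (v \<otimes> w) = app f v \<otimes> app g w"
  by (simp add: app_tensor_map tensor_lift_tens cbilinear_tensor_map)

lemma lin_eqI_tens:
  "(\<And>v w. app f (v \<otimes> w) = app g (v \<otimes> w)) \<Longrightarrow> f = g"
  by (rule lin_eqI) (rule clinear_eq_on_tens[OF clinear_app clinear_app])

lemma lin_eqI_vec:
  "(\<And>k. app f (vec k) = app g (vec k)) \<Longrightarrow> f = g"
  by (rule lin_eqI) (rule clinear_eq_on_vec[OF clinear_app clinear_app])

text \<open>The representation of \<open>A \<otimes> B\<close> on \<open>V \<otimes> W\<close> induced by representations of \<open>A\<close> on \<open>V\<close>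
  and of \<open>B\<close> on \<open>W\<close>.\<close>

definition tensor_rep ::
    "('a::calgebra \<Rightarrow> 'v::cvector lin) \<Rightarrow> ('b::calgebra \<Rightarrow> 'w::cvector lin) \<Rightarrow>
      ('a, 'b) tensor \<Rightarrow> ('v, 'w) tensor lin"
  where "tensor_rep \<rho> \<sigma> = tensor_lift (\<lambda>a b. tensor_map (\<rho> a) (\<sigma> b))"

lemma cbilinear_tensor_rep:
  assumes "clinear \<rho>" "clinear \<sigma>"
  shows "cbilinear (\<lambda>a b. tensor_map (\<rho> a) (\<sigma> b))"
  using assms
  by (auto simp: cbilinear_def clinear_add clinear_scaleC tens_add_left tens_add_right
      tens_scaleC_left tens_scaleC_right intro!: clinearI lin_eqI_tens)

lemma tensor_rep_tens:
  assumes "clinear \<rho>" "clinear \<sigma>"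
  shows "tensor_rep \<rho> \<sigma> (a \<otimes> b) = tensor_map (\<rho> a) (\<sigma> b)"
  by (simp add: tensor_rep_def tensor_lift_tens cbilinear_tensor_rep assms)

lemma algebra_hom_tensor_rep:
  assumes "algebra_hom \<rho>" "algebra_hom \<sigma>"
  shows "algebra_hom (tensor_rep \<rho> \<sigma>)"
proof -
  note lin = assms[THEN algebra_hom_clinear]
  have L: "clinear (tensor_rep \<rho> \<sigma>)"
    unfolding tensor_rep_def by (rule clinear_tensor_lift[OF cbilinear_tensor_rep[OF lin]])
  have pure: "tensor_rep \<rho> \<sigma> ((a \<otimes> b) * t) = tensor_rep \<rho> \<sigma> (a \<otimes> b) * tensor_rep \<rho> \<sigma> t" for a b t
  proof (induction t rule: tensor_induct)
    case (tens a' b')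
    show ?case
      by (rule lin_eqI_tens) (simp add: tensor_rep_tens lin algebra_hom_mult assms)
  next
    case (add s t)
    then show ?case by (simp add: distrib_left clinear_add[OF L])
  qed
  have "tensor_rep \<rho> \<sigma> (s * t) = tensor_rep \<rho> \<sigma> s * tensor_rep \<rho> \<sigma> t" for s t
    by (induction s rule: tensor_induct) (simp_all add: pure distrib_right clinear_add[OF L])
  moreover have "tensor_rep \<rho> \<sigma> 1 = 1"
    by (rule lin_eqI_tens) (simp add: one_tensor_def tensor_rep_tens lin algebra_hom_one assms)
  ultimately show ?thesis using L by (simp add: algebra_hom_def)
qed

subsection \<open>Algebras given by generators and relations\<close>

datatype 'g word = Word (letters: "'g list")

instantiation word :: (type) monoid_add
begin
definition zero_word :: "'a word" where "zero_word = Word []"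
definition plus_word :: "'a word \<Rightarrow> 'a word \<Rightarrow> 'a word"
  where "plus_word u v = Word (letters u @ letters v)"
instance by standard (simp_all add: zero_word_def plus_word_def)
end

text \<open>The free algebra on \<open>'g\<close>: the monoid algebra of the free monoid.\<close>

type_synonym 'g free_algebra = "'g word \<Rightarrow>\<^sub>0 complex"

definition gen :: "'g \<Rightarrow> 'g free_algebra"
  where "gen g = vec (Word [g])"

definition free_lift :: "('g \<Rightarrow> 'b::calgebra) \<Rightarrow> 'g free_algebra \<Rightarrow> 'b"
  where "free_lift f = lin_ext (\<lambda>w. prod_list (map f (letters w)))"

lemma free_mult_scaleC:
  fixes p q :: "'g free_algebra"
  shows "(c *\<^sub>C p) * q = c *\<^sub>C (p * q)" and "p * (c *\<^sub>C q) = c *\<^sub>C (p * q)"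
proof -
  have l: "c *\<^sub>C r = Poly_Mapping.single 0 c * r" for c and r :: "'g free_algebra"
    using mult_map_scale_conv_mult[of c r]
    by (simp add: scaleC_poly_mapping_def scaleC_complex_def)
  have r: "r * Poly_Mapping.single 0 c = c *\<^sub>C r" for c and r :: "'g free_algebra"
  proof (induction r rule: vec_induct)
    case (vec k)
    then show ?case by (simp add: mult_single flip: single_eq_scaleC)
  next
    case (scale d r)
    have "d *\<^sub>C r * Poly_Mapping.single 0 c = d *\<^sub>C (r * Poly_Mapping.single 0 c)"
      by (simp only: l mult.assoc)
    then show ?case by (simp add: scale mult.commute)
  qed (simp_all add: distrib_right scaleC_add_right)
  show "(c *\<^sub>C p) * q = c *\<^sub>C (p * q)" by (simp add: l mult.assoc)
  show "p * (c *\<^sub>C q) = c *\<^sub>C (p * q)" by (simp only: r[symmetric] mult.assoc)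
qed

lemma clinear_free_lift: "clinear (free_lift f)"
  unfolding free_lift_def by (rule clinear_lin_ext)

lemma free_lift_gen [simp]: "free_lift f (gen g) = f g"
  by (simp add: free_lift_def gen_def)

lemma free_lift_one [simp]: "free_lift f 1 = 1" for f :: "'g \<Rightarrow> 'b::calgebra"
proof -
  have 1: "(1 :: 'g free_algebra) = vec (Word [])"
    by (simp flip: single_one add: zero_word_def)
  show ?thesis unfolding 1 by (simp add: free_lift_def)
qed

lemma free_lift_mult [simp]: "free_lift f (p * q) = free_lift f p * free_lift f q"
proof -
  note L = clinear_add[OF clinear_free_lift] clinear_scaleC[OF clinear_free_lift]
    clinear_zero[OF clinear_free_lift]
  have "free_lift f (vec u * q) = free_lift f (vec u) * free_lift f q" for u
  proof (induction q rule: vec_induct)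
    case (vec v)
    then show ?case by (simp add: free_lift_def plus_word_def mult_single)
  qed (simp_all add: L distrib_left free_mult_scaleC)
  then show ?thesis
    by (induction p rule: vec_induct) (auto simp: L distrib_right free_mult_scaleC)
qed

lemmas free_lift_simps [simp] =
  clinear_add[OF clinear_free_lift] clinear_scaleC[OF clinear_free_lift]
  clinear_zero[OF clinear_free_lift] clinear_diff[OF clinear_free_lift]

lemma free_algebra_induct [case_names one gen mult add scale]:
  fixes p :: "'g free_algebra"
  assumes one: "P 1" and gen: "\<And>g. P (gen g)" and mult: "\<And>p q. P p \<Longrightarrow> P q \<Longrightarrow> P (p * q)"
    and add: "\<And>p q. P p \<Longrightarrow> P q \<Longrightarrow> P (p + q)" and scale: "\<And>c p. P p \<Longrightarrow> P (c *\<^sub>C p)"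
  shows "P p"
proof (induction p rule: vec_induct)
  case zero
  show ?case using scale[OF one, of 0] by simp
next
  case (vec w)
  have "P (vec (Word gs))" for gs
  proof (induction gs)
    case Nil
    have "vec (Word []) = (1 :: 'g free_algebra)" by (simp flip: single_one add: zero_word_def)
    then show ?case using one by simp
  next
    case (Cons g gs)
    have "vec (Word (g # gs)) = gen g * vec (Word gs)"
      by (simp add: gen_def mult_single plus_word_def)
    then show ?case using mult[OF gen[of g] Cons] by simp
  qed
  then show ?case by (cases w) auto
qed (auto intro: add scale)

text \<open>The two-sided ideal generated by \<open>R\<close>.\<close>

inductive_set ideal_gen :: "'a::ring_1 set \<Rightarrow> 'a set" for R where
  zero: "0 \<in> ideal_gen R"
| gen: "r \<in> R \<Longrightarrow> x * r * y \<in> ideal_gen R"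
| add: "p \<in> ideal_gen R \<Longrightarrow> q \<in> ideal_gen R \<Longrightarrow> p + q \<in> ideal_gen R"

lemma ideal_gen_mult_left: "p \<in> ideal_gen R \<Longrightarrow> x * p \<in> ideal_gen R"
  by (induction rule: ideal_gen.induct)
    (auto simp: distrib_left ideal_gen.intros simp flip: mult.assoc)

lemma ideal_gen_mult_right: "p \<in> ideal_gen R \<Longrightarrow> p * x \<in> ideal_gen R"
  by (induction rule: ideal_gen.induct)
    (auto simp: distrib_right ideal_gen.zero ideal_gen.add mult.assoc, simp add: ideal_gen.gen flip: mult.assoc[of _ _ "_ * _"])

lemma ideal_gen_incl: "r \<in> R \<Longrightarrow> r \<in> ideal_gen R"
  using ideal_gen.gen[of r R 1 1] by simp

lemma ideal_gen_uminus: "p \<in> ideal_gen R \<Longrightarrow> - p \<in> ideal_gen R"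
  using ideal_gen_mult_left[of p R "-1"] by simp

lemma ideal_gen_diff: "p \<in> ideal_gen R \<Longrightarrow> q \<in> ideal_gen R \<Longrightarrow> p - q \<in> ideal_gen R"
  using ideal_gen.add[OF _ ideal_gen_uminus, of p R q] by simp

lemma ideal_gen_scaleC: "p \<in> ideal_gen R \<Longrightarrow> c *\<^sub>C p \<in> ideal_gen R" for p :: "'g free_algebra"
  using ideal_gen_mult_left[of p R "c *\<^sub>C 1"] by (simp add: free_mult_scaleC)

lemma equivp_ideal_gen: "equivp (\<lambda>p q. p - q \<in> ideal_gen R)"
proof (rule equivpI)
  show "reflp (\<lambda>p q. p - q \<in> ideal_gen R)"
    by (simp add: reflp_def ideal_gen.zero)
  show "symp (\<lambda>p q. p - q \<in> ideal_gen R)"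
    using ideal_gen_uminus by (force simp: symp_def)
  show "transp (\<lambda>p q. p - q \<in> ideal_gen R)"
    using ideal_gen.add by (force simp: transp_def)
qed

lemma ideal_gen_cong_add:
  "p - p' \<in> ideal_gen R \<Longrightarrow> q - q' \<in> ideal_gen R \<Longrightarrow> (p + q) - (p' + q') \<in> ideal_gen R"
  by (subst add_diff_add) (rule ideal_gen.add)

lemma ideal_gen_cong_uminus: "p - p' \<in> ideal_gen R \<Longrightarrow> - p - - p' \<in> ideal_gen R"
  using ideal_gen_uminus[of "p - p'" R] by simp

lemma ideal_gen_cong_diff:
  "p - p' \<in> ideal_gen R \<Longrightarrow> q - q' \<in> ideal_gen R \<Longrightarrow> (p - q) - (p' - q') \<in> ideal_gen R"
  using ideal_gen_cong_add[OF _ ideal_gen_cong_uminus, of p p' R q q'] by simp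

lemma ideal_gen_cong_mult:
  assumes "p - p' \<in> ideal_gen R" "q - q' \<in> ideal_gen R"
  shows "p * q - p' * q' \<in> ideal_gen R"
proof -
  have "p * q - p' * q' = (p - p') * q + p' * (q - q')" by (simp add: algebra_simps)
  then show ?thesis
    using assms by (simp add: ideal_gen.add ideal_gen_mult_left ideal_gen_mult_right)
qed

lemma ideal_gen_cong_scaleC:
  "p - p' \<in> ideal_gen R \<Longrightarrow> c *\<^sub>C p - c *\<^sub>C p' \<in> ideal_gen R" for p :: "'g free_algebra"
  using ideal_gen_scaleC by (simp flip: scaleC_diff_right)

lemma free_lift_ideal_gen:
  assumes "p \<in> ideal_gen R" "\<And>r. r \<in> R \<Longrightarrow> free_lift f r = 0"
  shows "free_lift f p = 0"
  using assms(1) by induction (simp_all add: assms(2))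

lemma free_lift_range_commute:
  assumes "\<And>g. x * f g = f g * x"
  shows "x * free_lift f p = free_lift f p * x"
proof (induction p rule: free_algebra_induct)
  case (mult p q)
  have "x * (free_lift f p * free_lift f q) = free_lift f p * x * free_lift f q"
    by (simp add: mult flip: mult.assoc)
  then show ?case by (simp add: mult mult.assoc)
qed (simp_all add: assms distrib_left distrib_right)

section \<open>The enveloping algebra of \<open>sl\<^sub>2\<close>\<close>

datatype sl2_gen = E_gen | F_gen | H_gen

definition sl2_rels :: "sl2_gen free_algebra set"
  where "sl2_rels =
    {gen H_gen * gen E_gen - gen E_gen * gen H_gen - 2 *\<^sub>C gen E_gen,
     gen H_gen * gen F_gen - gen F_gen * gen H_gen - (- 2) *\<^sub>C gen F_gen,
     gen E_gen * gen F_gen - gen F_gen * gen E_gen - gen H_gen}"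

quotient_type usl2 = "sl2_gen free_algebra" / "\<lambda>p q. p - q \<in> ideal_gen sl2_rels"
  by (rule equivp_ideal_gen)

instantiation usl2 :: calgebra
begin

lift_definition zero_usl2 :: usl2 is 0 .
lift_definition one_usl2 :: usl2 is 1 .
lift_definition plus_usl2 :: "usl2 \<Rightarrow> usl2 \<Rightarrow> usl2" is "(+)" by (rule ideal_gen_cong_add)
lift_definition uminus_usl2 :: "usl2 \<Rightarrow> usl2" is uminus by (rule ideal_gen_cong_uminus)
lift_definition minus_usl2 :: "usl2 \<Rightarrow> usl2 \<Rightarrow> usl2" is "(-)" by (rule ideal_gen_cong_diff)
lift_definition times_usl2 :: "usl2 \<Rightarrow> usl2 \<Rightarrow> usl2" is "(*)" by (rule ideal_gen_cong_mult)
lift_definition scaleC_usl2 :: "complex \<Rightarrow> usl2 \<Rightarrow> usl2" is "(*\<^sub>C)" by (rule ideal_gen_cong_scaleC)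

instance
proof
  fix a b c :: usl2 and x y
  show "a + b + c = a + (b + c)" "a * b * c = a * (b * c)" 
    by (transfer, simp add: add.assoc mult.assoc ideal_gen.zero)+
  show "a + b = b + a"
    by (transfer, simp add: add.commute ideal_gen.zero)
  show "0 + a = a" "- a + a = 0" "a - b = a + - b" "1 *\<^sub>C a = a" "x *\<^sub>C (y *\<^sub>C a) = (x * y) *\<^sub>C a"
    "1 * a = a" "a * 1 = a"
    by (transfer, simp add: ideal_gen.zero)+
  show "x *\<^sub>C (a + b) = x *\<^sub>C a + x *\<^sub>C b" "(x + y) *\<^sub>C a = x *\<^sub>C a + y *\<^sub>C a"
    by (transfer, simp add: ideal_gen.zero scaleC_add_right scaleC_add_left)+
  show "(a + b) * c = a * c + b * c" "a * (b + c) = a * b + a * c"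
    by (transfer, simp add: ideal_gen.zero distrib_left distrib_right)+
  show "x *\<^sub>C a * b = x *\<^sub>C (a * b)" "a * x *\<^sub>C b = x *\<^sub>C (a * b)"
    by (transfer, simp add: ideal_gen.zero free_mult_scaleC)+
qed

end

definition usl2_lift :: "(sl2_gen \<Rightarrow> 'b::calgebra) \<Rightarrow> usl2 \<Rightarrow> 'b"
  where "usl2_lift f u = free_lift f (rep_usl2 u)"

lemma usl2_lift_abs:
  assumes "\<And>r. r \<in> sl2_rels \<Longrightarrow> free_lift f r = 0"
  shows "usl2_lift f (abs_usl2 p) = free_lift f p"
proof -
  have "rep_usl2 (abs_usl2 p) - p \<in> ideal_gen sl2_rels"
    using Quotient3_usl2 by (rule rep_abs_rsp_left) (simp add: ideal_gen.zero)
  from free_lift_ideal_gen[OF this assms] show ?thesis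
    by (simp add: usl2_lift_def)
qed

lemma algebra_hom_usl2_lift:
  assumes "\<And>r. r \<in> sl2_rels \<Longrightarrow> free_lift f r = 0"
  shows "algebra_hom (usl2_lift f)"
proof -
  note L = usl2_lift_abs[of f, OF assms]
  have "usl2_lift f (a + b) = usl2_lift f a + usl2_lift f b"
    "usl2_lift f (a * b) = usl2_lift f a * usl2_lift f b" for a b
    by (induct a, induct b, simp add: L plus_usl2.abs_eq times_usl2.abs_eq)+
  moreover have "usl2_lift f (c *\<^sub>C a) = c *\<^sub>C usl2_lift f a" for a c
    by (induct a) (simp add: L scaleC_usl2.abs_eq)
  moreover have "usl2_lift f 1 = 1" by (simp add: L one_usl2.abs_eq)
  ultimately show ?thesis by (simp add: algebra_hom_def clinear_def)
qed

definition sl2_triple :: "'a::calgebra \<Rightarrow> 'a \<Rightarrow> 'a \<Rightarrow> bool"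
  where "sl2_triple e f h \<longleftrightarrow>
    h * e - e * h = 2 *\<^sub>C e \<and> h * f - f * h = (- 2) *\<^sub>C f \<and> e * f - f * e = h"

lift_definition usl2_E :: usl2 is "gen E_gen" .
lift_definition usl2_F :: usl2 is "gen F_gen" .
lift_definition usl2_H :: usl2 is "gen H_gen" .

definition casimir :: usl2
  where "casimir = usl2_E * usl2_F + usl2_F * usl2_E + (1/2) *\<^sub>C usl2_H ^ 2"

lemma sl2_triple_usl2: "sl2_triple usl2_E usl2_F usl2_H"
  unfolding sl2_triple_def
  by (intro conjI; transfer) (rule ideal_gen_incl, simp add: sl2_rels_def)+

text \<open>The algebra homomorphism with \<open>E \<mapsto> e\<close>, \<open>F \<mapsto> f\<close>, \<open>H \<mapsto> h\<close>, provided that these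
  satisfy the \<open>sl\<^sub>2\<close> relations.\<close>

definition usl2_hom :: "'a::calgebra \<Rightarrow> 'a \<Rightarrow> 'a \<Rightarrow> usl2 \<Rightarrow> 'a"
  where "usl2_hom e f h = usl2_lift (case_sl2_gen e f h)"

lemma usl2_hom:
  assumes "sl2_triple e f h"
  shows algebra_hom_usl2_hom: "algebra_hom (usl2_hom e f h)"
    and usl2_hom_E: "usl2_hom e f h usl2_E = e"
    and usl2_hom_F: "usl2_hom e f h usl2_F = f"
    and usl2_hom_H: "usl2_hom e f h usl2_H = h"
proof -
  have *: "\<And>r. r \<in> sl2_rels \<Longrightarrow> free_lift (case_sl2_gen e f h) r = 0"
    using assms by (auto simp: sl2_rels_def sl2_triple_def)
  show "algebra_hom (usl2_hom e f h)"
    unfolding usl2_hom_def by (rule algebra_hom_usl2_lift) (rule *)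
  show "usl2_hom e f h usl2_E = e" "usl2_hom e f h usl2_F = f" "usl2_hom e f h usl2_H = h"
    by (simp_all add: usl2_hom_def usl2_E.abs_eq usl2_F.abs_eq usl2_H.abs_eq usl2_lift_abs[OF *])
qed

definition primitive :: "usl2 \<Rightarrow> (usl2, usl2) tensor"
  where "primitive X = X \<otimes> 1 + 1 \<otimes> X"

definition comult :: "usl2 \<Rightarrow> (usl2, usl2) tensor"  (\<open>\<Delta>\<close>)
  where "\<Delta> = usl2_hom (primitive usl2_E) (primitive usl2_F) (primitive usl2_H)"

section \<open>The universal Hahn algebra\<close>

datatype hahn_gen = A_gen | B_gen | C_gen

definition hahn_alpha :: "'a \<Rightarrow> 'a \<Rightarrow> 'a \<Rightarrow> 'a::{cvector, ring, monoid_mult}"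
  where "hahn_alpha a b c = (c * a - a * c) + 2 *\<^sub>C a ^ 2 + b"

definition hahn_beta :: "'a \<Rightarrow> 'a \<Rightarrow> 'a \<Rightarrow> 'a::{cvector, ring, monoid_mult}"
  where "hahn_beta a b c = (b * c - c * b) + 4 *\<^sub>C (b * a) + 2 *\<^sub>C c"

definition hahn_rels :: "hahn_gen free_algebra set"
  where "hahn_rels =
    (let a = gen A_gen; b = gen B_gen; c = gen C_gen;
         \<alpha> = hahn_alpha a b c; \<beta> = hahn_beta a b c
     in {a * b - b * a - c} \<union> range (\<lambda>p. \<alpha> * p - p * \<alpha>) \<union> range (\<lambda>p. \<beta> * p - p * \<beta>))"

quotient_type hahn = "hahn_gen free_algebra" / "\<lambda>p q. p - q \<in> ideal_gen hahn_rels"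
  by (rule equivp_ideal_gen)

instantiation hahn :: calgebra
begin

lift_definition zero_hahn :: hahn is 0 .
lift_definition one_hahn :: hahn is 1 .
lift_definition plus_hahn :: "hahn \<Rightarrow> hahn \<Rightarrow> hahn" is "(+)" by (rule ideal_gen_cong_add)
lift_definition uminus_hahn :: "hahn \<Rightarrow> hahn" is uminus by (rule ideal_gen_cong_uminus)
lift_definition minus_hahn :: "hahn \<Rightarrow> hahn \<Rightarrow> hahn" is "(-)" by (rule ideal_gen_cong_diff)
lift_definition times_hahn :: "hahn \<Rightarrow> hahn \<Rightarrow> hahn" is "(*)" by (rule ideal_gen_cong_mult)
lift_definition scaleC_hahn :: "complex \<Rightarrow> hahn \<Rightarrow> hahn" is "(*\<^sub>C)" by (rule ideal_gen_cong_scaleC)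

instance
proof
  fix a b c :: hahn and x y
  show "a + b + c = a + (b + c)" "a * b * c = a * (b * c)" 
    by (transfer, simp add: add.assoc mult.assoc ideal_gen.zero)+
  show "a + b = b + a"
    by (transfer, simp add: add.commute ideal_gen.zero)
  show "0 + a = a" "- a + a = 0" "a - b = a + - b" "1 *\<^sub>C a = a" "x *\<^sub>C (y *\<^sub>C a) = (x * y) *\<^sub>C a"
    "1 * a = a" "a * 1 = a"
    by (transfer, simp add: ideal_gen.zero)+
  show "x *\<^sub>C (a + b) = x *\<^sub>C a + x *\<^sub>C b" "(x + y) *\<^sub>C a = x *\<^sub>C a + y *\<^sub>C a"
    by (transfer, simp add: ideal_gen.zero scaleC_add_right scaleC_add_left)+
  show "(a + b) * c = a * c + b * c" "a * (b + c) = a * b + a * c"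
    by (transfer, simp add: ideal_gen.zero distrib_left distrib_right)+
  show "x *\<^sub>C a * b = x *\<^sub>C (a * b)" "a * x *\<^sub>C b = x *\<^sub>C (a * b)"
    by (transfer, simp add: ideal_gen.zero free_mult_scaleC)+
qed

end

definition hahn_lift :: "(hahn_gen \<Rightarrow> 'b::calgebra) \<Rightarrow> hahn \<Rightarrow> 'b"
  where "hahn_lift f u = free_lift f (rep_hahn u)"

lemma hahn_lift_abs:
  assumes "\<And>r. r \<in> hahn_rels \<Longrightarrow> free_lift f r = 0"
  shows "hahn_lift f (abs_hahn p) = free_lift f p"
proof -
  have "rep_hahn (abs_hahn p) - p \<in> ideal_gen hahn_rels"
    using Quotient3_hahn by (rule rep_abs_rsp_left) (simp add: ideal_gen.zero)
  from free_lift_ideal_gen[OF this assms] show ?thesis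
    by (simp add: hahn_lift_def)
qed

lemma algebra_hom_hahn_lift:
  assumes "\<And>r. r \<in> hahn_rels \<Longrightarrow> free_lift f r = 0"
  shows "algebra_hom (hahn_lift f)"
proof -
  note L = hahn_lift_abs[of f, OF assms]
  have "hahn_lift f (a + b) = hahn_lift f a + hahn_lift f b"
    "hahn_lift f (a * b) = hahn_lift f a * hahn_lift f b" for a b
    by (induct a, induct b, simp add: L plus_hahn.abs_eq times_hahn.abs_eq)+
  moreover have "hahn_lift f (c *\<^sub>C a) = c *\<^sub>C hahn_lift f a" for a c
    by (induct a) (simp add: L scaleC_hahn.abs_eq)
  moreover have "hahn_lift f 1 = 1" by (simp add: L one_hahn.abs_eq)
  ultimately show ?thesis by (simp add: algebra_hom_def clinear_def)
qed


lift_definition hahn_A :: hahn is "gen A_gen" .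
lift_definition hahn_B :: hahn is "gen B_gen" .
lift_definition hahn_C :: hahn is "gen C_gen" .

lemma hahn_relations:
  shows "hahn_A * hahn_B - hahn_B * hahn_A = hahn_C"
    and "hahn_alpha hahn_A hahn_B hahn_C * x = x * hahn_alpha hahn_A hahn_B hahn_C"
    and "hahn_beta hahn_A hahn_B hahn_C * x = x * hahn_beta hahn_A hahn_B hahn_C"
proof -
  show "hahn_A * hahn_B - hahn_B * hahn_A = hahn_C"
    by transfer (rule ideal_gen_incl, simp add: hahn_rels_def Let_def)
  show "hahn_alpha hahn_A hahn_B hahn_C * x = x * hahn_alpha hahn_A hahn_B hahn_C"
    unfolding hahn_alpha_def power2_eq_square
    by transfer (rule ideal_gen_incl, simp add: hahn_rels_def Let_def hahn_alpha_def power2_eq_square)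
  show "hahn_beta hahn_A hahn_B hahn_C * x = x * hahn_beta hahn_A hahn_B hahn_C"
    unfolding hahn_beta_def
    by transfer (rule ideal_gen_incl, simp add: hahn_rels_def Let_def hahn_beta_def)
qed

definition hahn_hom :: "'a::calgebra \<Rightarrow> 'a \<Rightarrow> 'a \<Rightarrow> hahn \<Rightarrow> 'a"
  where "hahn_hom a b c = hahn_lift (case_hahn_gen a b c)"

lemma hahn_hom:
  assumes ab: "a * b - b * a = c"
    and \<alpha>: "\<And>x. x \<in> {a, b, c} \<Longrightarrow> hahn_alpha a b c * x = x * hahn_alpha a b c"
    and \<beta>: "\<And>x. x \<in> {a, b, c} \<Longrightarrow> hahn_beta a b c * x = x * hahn_beta a b c"
  shows algebra_hom_hahn_hom: "algebra_hom (hahn_hom a b c)"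
    and hahn_hom_A: "hahn_hom a b c hahn_A = a"
    and hahn_hom_B: "hahn_hom a b c hahn_B = b"
    and hahn_hom_C: "hahn_hom a b c hahn_C = c"
proof -
  let ?f = "case_hahn_gen a b c"
  have cent: "x * free_lift ?f p = free_lift ?f p * x" if "\<And>y. y \<in> {a, b, c} \<Longrightarrow> x * y = y * x" for x p
    by (rule free_lift_range_commute) (auto split: hahn_gen.split simp: that)
  have "free_lift ?f (hahn_alpha (gen A_gen) (gen B_gen) (gen C_gen)) = hahn_alpha a b c"
    "free_lift ?f (hahn_beta (gen A_gen) (gen B_gen) (gen C_gen)) = hahn_beta a b c"
    by (simp_all add: hahn_alpha_def hahn_beta_def power2_eq_square)
  then have *: "\<And>r. r \<in> hahn_rels \<Longrightarrow> free_lift ?f r = 0"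
    using ab cent[OF \<alpha>] cent[OF \<beta>] by (auto simp: hahn_rels_def Let_def)
  show "algebra_hom (hahn_hom a b c)"
    unfolding hahn_hom_def by (rule algebra_hom_hahn_lift) (rule *)
  show "hahn_hom a b c hahn_A = a" "hahn_hom a b c hahn_B = b" "hahn_hom a b c hahn_C = c"
    by (simp_all add: hahn_hom_def hahn_A.abs_eq hahn_B.abs_eq hahn_C.abs_eq hahn_lift_abs[OF *])
qed

definition hahn_natural :: "hahn \<Rightarrow> (usl2, usl2) tensor"  (\<open>\<natural>\<close>)
  where "\<natural> = hahn_hom
    ((1/4) *\<^sub>C (usl2_H \<otimes> 1 - 1 \<otimes> usl2_H))
    ((1/2) *\<^sub>C \<Delta> casimir)
    (usl2_E \<otimes> usl2_F - usl2_F \<otimes> usl2_E)"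

section \<open>The modules on subsets of a finite set\<close>

text \<open>The space with basis \<open>2\<^sup>S\<close> is the subspace \<open>cube S\<close> of the free vector space on all sets.
  The \<open>sl\<^sub>2\<close> operators attached to \<open>S\<close> are extended by zero to the basis vectors outside \<open>Pow S\<close>,
  so that they satisfy the \<open>sl\<^sub>2\<close> relations everywhere; only their action on \<open>cube S\<close> matters.\<close>

definition cube :: "'a set \<Rightarrow> ('a set \<Rightarrow>\<^sub>0 complex) set"
  where "cube S = {v. Poly_Mapping.keys v \<subseteq> Pow S}"

definition cube_E :: "'a set \<Rightarrow> ('a set \<Rightarrow>\<^sub>0 complex) lin"
  where "cube_E S = Abs_lin (lin_ext (\<lambda>x.
    if x \<subseteq> S then \<Sum>y | y \<subseteq> x \<and> card y + 1 = card x. vec y else 0))"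

definition cube_F :: "'a set \<Rightarrow> ('a set \<Rightarrow>\<^sub>0 complex) lin"
  where "cube_F S = Abs_lin (lin_ext (\<lambda>x.
    if x \<subseteq> S then \<Sum>y | x \<subseteq> y \<and> y \<subseteq> S \<and> card y = card x + 1. vec y else 0))"

definition cube_H :: "'a set \<Rightarrow> ('a set \<Rightarrow>\<^sub>0 complex) lin"
  where "cube_H S = Abs_lin (lin_ext (\<lambda>x.
    if x \<subseteq> S then (of_nat (card S) - 2 * of_nat (card x)) *\<^sub>C vec x else 0))"

definition cube_rep :: "'a set \<Rightarrow> usl2 \<Rightarrow> ('a set \<Rightarrow>\<^sub>0 complex) lin"
  where "cube_rep S = usl2_hom (cube_E S) (cube_F S) (cube_H S)"

definition cube_split ::
    "'a set \<Rightarrow> ('a set \<Rightarrow>\<^sub>0 complex) \<Rightarrow> ('a set \<Rightarrow>\<^sub>0 complex, 'a set \<Rightarrow>\<^sub>0 complex) tensor"  (\<open>\<iota>\<close>)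
  where "\<iota> x\<^sub>0 = lin_ext (\<lambda>x. vec (x - x\<^sub>0) \<otimes> vec (x \<inter> x\<^sub>0))"

definition usl2_tensor_act ::
    "'a set \<Rightarrow> 'a set \<Rightarrow> (usl2, usl2) tensor \<Rightarrow> ('a set \<Rightarrow>\<^sub>0 complex) \<Rightarrow> ('a set \<Rightarrow>\<^sub>0 complex)"
  where "usl2_tensor_act \<Omega> x\<^sub>0 t v =
    inv_into (cube \<Omega>) (\<iota> x\<^sub>0) (app (tensor_rep (cube_rep (\<Omega> - x\<^sub>0)) (cube_rep x\<^sub>0) t) (\<iota> x\<^sub>0 v))"

definition hahn_act ::
    "'a set \<Rightarrow> 'a set \<Rightarrow> hahn \<Rightarrow> ('a set \<Rightarrow>\<^sub>0 complex) \<Rightarrow> ('a set \<Rightarrow>\<^sub>0 complex)"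
  where "hahn_act \<Omega> x\<^sub>0 h v = usl2_tensor_act \<Omega> x\<^sub>0 (\<natural> h) v"

section \<open>Well-definedness\<close>

lemma commute_intros:
  fixes x y z :: "'a::calgebra"
  shows "x * y = y * x \<Longrightarrow> x * z = z * x \<Longrightarrow> x * (y + z) = (y + z) * x"
    and "x * y = y * x \<Longrightarrow> x * z = z * x \<Longrightarrow> x * (y - z) = (y - z) * x"
    and "x * y = y * x \<Longrightarrow> x * z = z * x \<Longrightarrow> x * (y * z) = (y * z) * x"
    and "x * y = y * x \<Longrightarrow> x * c *\<^sub>C y = c *\<^sub>C y * x"
    and "x * y = y * x \<Longrightarrow> x * y ^ 2 = y ^ 2 * x"
proof -
  show *: "x * y = y * x \<Longrightarrow> x * z = z * x \<Longrightarrow> x * (y * z) = (y * z) * x" for y z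
    by (metis mult.assoc)
  show "x * y = y * x \<Longrightarrow> x * y ^ 2 = y ^ 2 * x"
    by (simp only: power2_eq_square *)
qed (simp_all add: distrib_left distrib_right right_diff_distrib left_diff_distrib)

lemma scaleC_small:
  fixes x :: "'a::cvector"
  shows "2 *\<^sub>C x = x + x" "4 *\<^sub>C x = x + x + x + x" "8 *\<^sub>C x = x + x + x + x + x + x + x + x"
proof -
  show 2: "2 *\<^sub>C x = x + x" for x :: 'a
    using scaleC_add_left[of 1 1 x] by simp
  show 4: "4 *\<^sub>C x = x + x + x + x" for x :: 'a
    using scaleC_scaleC[of 2 2 x] by (simp add: 2 add.assoc del: scaleC_scaleC)
  show "8 *\<^sub>C x = x + x + x + x + x + x + x + x"
    using scaleC_scaleC[of 2 4 x] by (simp add: 2 4 add.assoc del: scaleC_scaleC)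
qed

lemma sl2_triple_rules:
  assumes "sl2_triple e f h"
  shows "h * e = e * h + (e + e)" "h * f = f * h - (f + f)" "f * e = e * f - h"
    and "h * (e * z) = e * (h * z) + (e * z + e * z)"
    and "h * (f * z) = f * (h * z) - (f * z + f * z)"
    and "f * (e * z) = e * (f * z) - h * z"
proof -
  show he: "h * e = e * h + (e + e)" and hf: "h * f = f * h - (f + f)" and fe: "f * e = e * f - h"
    using assms by (auto simp: sl2_triple_def scaleC_small algebra_simps)
  show "h * (e * z) = e * (h * z) + (e * z + e * z)"
    "h * (f * z) = f * (h * z) - (f * z + f * z)"
    "f * (e * z) = e * (f * z) - h * z"
    by (simp_all add: he hf fe algebra_simps flip: mult.assoc)
qed

lemma casimir_commute:
  assumes "sl2_triple e f h" "x \<in> {e, f, h}"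
  shows "(e * f + f * e + (1/2) *\<^sub>C h ^ 2) * x = x * (e * f + f * e + (1/2) *\<^sub>C h ^ 2)"
  by (rule scaleC_eqD[of 2])
    (use assms(2) in \<open>auto simp: power2_eq_square scaleC_add_right distrib_left distrib_right\<close>,
     simp_all add: scaleC_small algebra_simps sl2_triple_rules[OF assms(1)])

lemma hahn_relations_sl2_pair:
  fixes e1 f1 h1 e2 f2 h2 :: "'a::calgebra"
  assumes t1: "sl2_triple e1 f1 h1" and t2: "sl2_triple e2 f2 h2"
    and comm: "\<And>x y. x \<in> {e1, f1, h1} \<Longrightarrow> y \<in> {e2, f2, h2} \<Longrightarrow> y * x = x * y"
  defines "L \<equiv> (e1 + e2) * (f1 + f2) + (f1 + f2) * (e1 + e2) + (1/2) *\<^sub>C (h1 + h2) ^ 2"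
  defines "a \<equiv> (1/4) *\<^sub>C (h1 - h2)" and "b \<equiv> (1/2) *\<^sub>C L" and "c \<equiv> e1 * f2 - f1 * e2"
  shows "a * b - b * a = c"
    and "x \<in> {a, b, c} \<Longrightarrow> hahn_alpha a b c * x = x * hahn_alpha a b c"
    and "x \<in> {a, b, c} \<Longrightarrow> hahn_beta a b c * x = x * hahn_beta a b c"
proof -
  define L1 where "L1 = e1 * f1 + f1 * e1 + (1/2) *\<^sub>C h1 ^ 2"
  define L2 where "L2 = e2 * f2 + f2 * e2 + (1/2) *\<^sub>C h2 ^ 2"
  have cz: "y * (x * z) = x * (y * z)" if "x \<in> {e1, f1, h1}" "y \<in> {e2, f2, h2}" for x y z
    using comm[OF that] by (simp flip: mult.assoc)
  have comms: "e2 * e1 = e1 * e2" "e2 * f1 = f1 * e2" "e2 * h1 = h1 * e2"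
    "f2 * e1 = e1 * f2" "f2 * f1 = f1 * f2" "f2 * h1 = h1 * f2"
    "h2 * e1 = e1 * h2" "h2 * f1 = f1 * h2" "h2 * h1 = h1 * h2"
    by (rule comm; simp)+
  have czs: "e2 * (e1 * z) = e1 * (e2 * z)" "e2 * (f1 * z) = f1 * (e2 * z)"
    "e2 * (h1 * z) = h1 * (e2 * z)" "f2 * (e1 * z) = e1 * (f2 * z)" "f2 * (f1 * z) = f1 * (f2 * z)"
    "f2 * (h1 * z) = h1 * (f2 * z)" "h2 * (e1 * z) = e1 * (h2 * z)" "h2 * (f1 * z) = f1 * (h2 * z)"
    "h2 * (h1 * z) = h1 * (h2 * z)" for z
    by (rule cz; simp)+
  note rules = sl2_triple_rules[OF t1] sl2_triple_rules[OF t2] comms czs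
  note distribs = scaleC_add_right scaleC_diff_right distrib_left distrib_right
    left_diff_distrib right_diff_distrib
  note expand = L_def a_def b_def c_def L1_def L2_def power2_eq_square hahn_alpha_def hahn_beta_def
  have t12: "sl2_triple (e1 + e2) (f1 + f2) (h1 + h2)"
    unfolding sl2_triple_def by (simp add: scaleC_small algebra_simps rules)
  show "a * b - b * a = c"
    by (rule scaleC_eqD[of 8])
      (simp_all add: expand distribs, simp add: scaleC_small algebra_simps rules)
  have alpha: "hahn_alpha a b c = (1/2) *\<^sub>C (L1 + L2) + (1/8) *\<^sub>C (h1 + h2) ^ 2"
    by (rule scaleC_eqD[of 8])
      (simp_all add: expand distribs, simp add: scaleC_small algebra_simps rules)
  have beta: "hahn_beta a b c = (1/2) *\<^sub>C ((L1 - L2) * (h1 + h2))"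
    by (rule scaleC_eqD[of 4])
      (simp_all add: expand distribs, simp add: scaleC_small algebra_simps rules)
  have L1: "L1 * e1 = e1 * L1" "L1 * f1 = f1 * L1" "L1 * h1 = h1 * L1"
    using casimir_commute[OF t1] by (auto simp: L1_def)
  have L2: "L2 * e2 = e2 * L2" "L2 * f2 = f2 * L2" "L2 * h2 = h2 * L2"
    using casimir_commute[OF t2] by (auto simp: L2_def)
  have L12: "L1 * y = y * L1" if "y \<in> {e2, f2, h2}" for y
    unfolding L1_def by (rule sym, intro commute_intros comm) (use that in auto)
  have L21: "L2 * y = y * L2" if "y \<in> {e1, f1, h1}" for y
    unfolding L2_def by (rule sym, intro commute_intros comm[symmetric]) (use that in auto)
  have La: "L1 * x = x * L1" "L2 * x = x * L2" if "x \<in> {a, b, c}" for x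
  proof -
    have L12s: "L1 * e2 = e2 * L1" "L1 * f2 = f2 * L1" "L1 * h2 = h2 * L1" by (rule L12; simp)+
    have L21s: "L2 * e1 = e1 * L2" "L2 * f1 = f1 * L2" "L2 * h1 = h1 * L2" by (rule L21; simp)+
    show "L1 * x = x * L1" "L2 * x = x * L2"
      using that by (auto simp: L_def a_def b_def c_def intro!: commute_intros L1 L2 L12s L21s)
  qed
  have H: "(h1 + h2) * x = x * (h1 + h2)" if x: "x \<in> {a, b, c}" for x
  proof -
    have "(h1 + h2) * a = a * (h1 + h2)" by (simp add: a_def distribs rules)
    moreover have "(h1 + h2) * b = b * (h1 + h2)"
      using casimir_commute[OF t12, of "h1 + h2"]
      by (simp only: b_def L_def mult_scaleC_left mult_scaleC_right) simp
    moreover have "(h1 + h2) * c = c * (h1 + h2)" by (simp add: c_def algebra_simps rules)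
    ultimately show ?thesis using x by auto
  qed
  show "hahn_alpha a b c * x = x * hahn_alpha a b c" if "x \<in> {a, b, c}" for x
  proof -
    note comm = La[OF that, symmetric] H[OF that, symmetric]
    show ?thesis unfolding alpha
      by (rule commute_intros(1)[OF commute_intros(4)[OF commute_intros(1)[OF comm(1,2)]]
            commute_intros(4)[OF commute_intros(5)[OF comm(3)]], symmetric])
  qed
  show "hahn_beta a b c * x = x * hahn_beta a b c" if "x \<in> {a, b, c}" for x
  proof -
    note comm = La[OF that, symmetric] H[OF that, symmetric]
    show ?thesis unfolding beta
      by (rule commute_intros(4)[OF commute_intros(3)[OF commute_intros(2)[OF comm(1,2)] comm(3)], symmetric])
  qed
qed

lemma tens_minus_left: "(- v) \<otimes> w = - (v \<otimes> w)"
  using tens_scaleC_left[of "-1" v w] by simp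

lemma tens_minus_right: "v \<otimes> (- w) = - (v \<otimes> w)"
  using tens_scaleC_right[of v "-1" w] by simp

lemma tens_diff_left: "(v - v') \<otimes> w = v \<otimes> w - v' \<otimes> w"
  using tens_add_left[of v "- v'" w] by (simp add: tens_minus_left)

lemma tens_diff_right: "v \<otimes> (w - w') = v \<otimes> w - v \<otimes> w'"
  using tens_add_right[of v w "- w'"] by (simp add: tens_minus_right)

lemma sl2_triple_tens:
  shows sl2_triple_tens_left: "sl2_triple (usl2_E \<otimes> 1) (usl2_F \<otimes> 1) (usl2_H \<otimes> (1::usl2))"
    and sl2_triple_tens_right: "sl2_triple ((1::usl2) \<otimes> usl2_E) (1 \<otimes> usl2_F) (1 \<otimes> usl2_H)"
  using sl2_triple_usl2
  by (simp add: sl2_triple_def flip: tens_diff_left tens_scaleC_left tens_minus_left,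
      simp add: sl2_triple_def flip: tens_diff_right tens_scaleC_right tens_minus_right)

lemma sl2_triple_add:
  assumes "sl2_triple e1 f1 h1" "sl2_triple e2 f2 h2"
    and "\<And>x y. x \<in> {e1, f1, h1} \<Longrightarrow> y \<in> {e2, f2, h2} \<Longrightarrow> y * x = x * y"
  shows "sl2_triple (e1 + e2) (f1 + f2) (h1 + h2)"
  using assms(1,2) assms(3)[of e1 f2] assms(3)[of e1 h2] assms(3)[of f1 e2] assms(3)[of f1 h2]
    assms(3)[of h1 e2] assms(3)[of h1 f2]
  by (auto simp: sl2_triple_def scaleC_add_right algebra_simps)

lemma sl2_triple_primitive:
  "sl2_triple (primitive usl2_E) (primitive usl2_F) (primitive usl2_H)"
  unfolding primitive_def by (rule sl2_triple_add[OF sl2_triple_tens]) auto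

lemma algebra_hom_comult: "algebra_hom \<Delta>"
  and comult_E: "\<Delta> usl2_E = usl2_E \<otimes> 1 + 1 \<otimes> usl2_E"
  and comult_F: "\<Delta> usl2_F = usl2_F \<otimes> 1 + 1 \<otimes> usl2_F"
  and comult_H: "\<Delta> usl2_H = usl2_H \<otimes> 1 + 1 \<otimes> usl2_H"
  using usl2_hom[OF sl2_triple_primitive] by (simp_all add: comult_def primitive_def)

lemma comult_casimir:
  "\<Delta> casimir = \<Delta> usl2_E * \<Delta> usl2_F + \<Delta> usl2_F * \<Delta> usl2_E + (1/2) *\<^sub>C \<Delta> usl2_H ^ 2"
  by (simp add: casimir_def power2_eq_square algebra_hom_simps algebra_hom_comult)

lemma algebra_hom_hahn_natural: "algebra_hom \<natural>"
  and hahn_natural_A: "\<natural> hahn_A = (1/4) *\<^sub>C (usl2_H \<otimes> 1 - 1 \<otimes> usl2_H)"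
  and hahn_natural_B: "\<natural> hahn_B = (1/2) *\<^sub>C \<Delta> casimir"
  and hahn_natural_C: "\<natural> hahn_C = usl2_E \<otimes> usl2_F - usl2_F \<otimes> usl2_E"
proof -
  have comm: "y * x = x * y"
    if "x \<in> {usl2_E \<otimes> 1, usl2_F \<otimes> 1, usl2_H \<otimes> 1}" "y \<in> {1 \<otimes> usl2_E, 1 \<otimes> usl2_F, 1 \<otimes> usl2_H}"
    for x y :: "(usl2, usl2) tensor"
    using that by auto
  have c: "usl2_E \<otimes> usl2_F - usl2_F \<otimes> usl2_E
      = (usl2_E \<otimes> 1) * (1 \<otimes> usl2_F) - (usl2_F \<otimes> 1) * (1 \<otimes> usl2_E)"
    by simp
  note rel = hahn_relations_sl2_pair[OF sl2_triple_tens comm]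
  note hom = hahn_hom[OF rel, folded comult_E comult_F comult_H, folded comult_casimir c]
  show "algebra_hom \<natural>"
    and "\<natural> hahn_A = (1/4) *\<^sub>C (usl2_H \<otimes> 1 - 1 \<otimes> usl2_H)"
    and "\<natural> hahn_B = (1/2) *\<^sub>C \<Delta> casimir"
    and "\<natural> hahn_C = usl2_E \<otimes> usl2_F - usl2_F \<otimes> usl2_E"
    unfolding hahn_natural_def by (rule hom; assumption)+
qed

lemma app_cube_vec:
  "app (cube_E S) (vec x) = (if x \<subseteq> S then \<Sum>y | y \<subseteq> x \<and> card y + 1 = card x. vec y else 0)"
  "app (cube_F S) (vec x) =
    (if x \<subseteq> S then \<Sum>y | x \<subseteq> y \<and> y \<subseteq> S \<and> card y = card x + 1. vec y else 0)"
  "app (cube_H S) (vec x) =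
    (if x \<subseteq> S then (of_nat (card S) - 2 * of_nat (card x)) *\<^sub>C vec x else 0)"
  by (simp_all add: cube_E_def cube_F_def cube_H_def app_Abs_lin clinear_lin_ext)

lemma lower_covers:
  assumes "finite x"
  shows "{y. y \<subseteq> x \<and> card y + 1 = card x} = (\<lambda>i. x - {i}) ` x"
proof (intro equalityI subsetI)
  fix y assume "y \<in> {y. y \<subseteq> x \<and> card y + 1 = card x}"
  then have y: "y \<subseteq> x" "card y + 1 = card x" by auto
  then have "card (x - y) = 1"
    using assms by (simp add: card_Diff_subset finite_subset)
  then obtain i where "x - y = {i}" by (auto simp: card_1_singleton_iff)
  then have "i \<in> x" "y = x - {i}" using y(1) by auto
  then show "y \<in> (\<lambda>i. x - {i}) ` x" by blast
next
  fix y assume "y \<in> (\<lambda>i. x - {i}) ` x"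
  then show "y \<in> {y. y \<subseteq> x \<and> card y + 1 = card x}"
    using assms by (auto simp: card_Suc_Diff1 simp del: card_Diff_insert)
qed

lemma upper_covers:
  assumes "finite S" "x \<subseteq> S"
  shows "{y. x \<subseteq> y \<and> y \<subseteq> S \<and> card y = card x + 1} = (\<lambda>i. insert i x) ` (S - x)"
proof (intro equalityI subsetI)
  fix y assume "y \<in> {y. x \<subseteq> y \<and> y \<subseteq> S \<and> card y = card x + 1}"
  then have y: "x \<subseteq> y" "y \<subseteq> S" "card y = card x + 1" by auto
  then have "card (y - x) = 1"
    using assms by (simp add: card_Diff_subset finite_subset)
  then obtain i where "y - x = {i}" by (auto simp: card_1_singleton_iff)
  then have "i \<in> S - x" "y = insert i x" using y(1,2) by auto
  then show "y \<in> (\<lambda>i. insert i x) ` (S - x)" by blast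
next
  fix y assume "y \<in> (\<lambda>i. insert i x) ` (S - x)"
  then show "y \<in> {y. x \<subseteq> y \<and> y \<subseteq> S \<and> card y = card x + 1}"
    using assms by (auto simp: finite_subset)
qed

lemma app_cube_E:
  assumes "finite S" "x \<subseteq> S"
  shows "app (cube_E S) (vec x) = (\<Sum>i\<in>x. vec (x - {i}))"
proof -
  have "inj_on (\<lambda>i. x - {i}) x" by (auto simp: inj_on_def)
  then show ?thesis
    using assms by (simp only: app_cube_vec lower_covers finite_subset sum.reindex) simp
qed

lemma app_cube_F:
  assumes "finite S" "x \<subseteq> S"
  shows "app (cube_F S) (vec x) = (\<Sum>i\<in>S - x. vec (insert i x))"
proof -
  have "inj_on (\<lambda>i. insert i x) (S - x)" by (auto simp: inj_on_def)
  then show ?thesis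
    using assms by (simp only: app_cube_vec upper_covers sum.reindex) simp
qed

lemma app_cube_H:
  assumes "x \<subseteq> S"
  shows "app (cube_H S) (vec x) = (of_nat (card S) - 2 * of_nat (card x)) *\<^sub>C vec x"
  using assms by (simp add: app_cube_vec)

lemma sum_const_scaleC: "(\<Sum>i\<in>A. v) = of_nat (card A) *\<^sub>C (v::'v::cvector)"
  by (induction A rule: infinite_finite_induct) (auto simp: scaleC_add_left)

lemma sl2_triple_cube:
  assumes S: "finite S"
  shows "sl2_triple (cube_E S) (cube_F S) (cube_H S)"
proof -
  note lin = clinear_sum[OF clinear_app] clinear_scaleC[OF clinear_app] clinear_zero[OF clinear_app]
  have out: "app (cube_E S) (vec x) = 0" "app (cube_F S) (vec x) = 0" "app (cube_H S) (vec x) = 0"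
    if "\<not> x \<subseteq> S" for x
    using that by (simp_all add: app_cube_vec)
  have HE: "app (cube_H S * cube_E S - cube_E S * cube_H S) (vec x) = app (2 *\<^sub>C cube_E S) (vec x)"
    if x: "x \<subseteq> S" for x
  proof -
    have fx: "finite x" using S x by (rule finite_subset[rotated])
    have "app (cube_H S) (vec (x - {i})) = (of_nat (card S) - 2 * of_nat (card x) + 2) *\<^sub>C vec (x - {i})"
      if i: "i \<in> x" for i
    proof -
      have "x - {i} \<subseteq> S" using x by auto
      moreover have "card x = card (x - {i}) + 1" using card_Suc_Diff1[OF fx i] by simp
      ultimately show ?thesis by (simp only: app_cube_H) (simp add: algebra_simps)
    qed
    then show ?thesis
      by (simp add: app_cube_E[OF S x] app_cube_H[OF x] lin scaleC_add_left scaleC_sum_right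
          sum.distrib cong: sum.cong)
  qed
  have HF: "app (cube_H S * cube_F S - cube_F S * cube_H S) (vec x) = app ((- 2) *\<^sub>C cube_F S) (vec x)"
    if x: "x \<subseteq> S" for x
  proof -
    have fx: "finite x" using S x by (rule finite_subset[rotated])
    have "app (cube_H S) (vec (insert i x)) = (of_nat (card S) - 2 * of_nat (card x) - 2) *\<^sub>C vec (insert i x)"
      if i: "i \<in> S - x" for i
    proof -
      have "insert i x \<subseteq> S" using x i by auto
      moreover have "card (insert i x) = card x + 1" using fx i by simp
      ultimately show ?thesis by (simp only: app_cube_H) (simp add: algebra_simps)
    qed
    then have "(\<Sum>i\<in>S - x. app (cube_H S) (vec (insert i x)))
        = (of_nat (card S) - 2 * of_nat (card x) - 2) *\<^sub>C (\<Sum>i\<in>S - x. vec (insert i x))"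
      unfolding scaleC_sum_right by (intro sum.cong refl)
    then show ?thesis
      by (simp add: app_cube_F[OF S x] app_cube_H[OF x] lin)
        (simp add: scaleC_diff_left app_cube_F[OF S x])
  qed
  have EF: "app (cube_E S * cube_F S - cube_F S * cube_E S) (vec x) = app (cube_H S) (vec x)"
    if x: "x \<subseteq> S" for x
  proof -
    have fx: "finite x" using S x by (rule finite_subset[rotated])
    have "app (cube_E S) (vec (insert i x)) = vec x + (\<Sum>j\<in>x. vec (insert i (x - {j})))"
      if i: "i \<in> S - x" for i
    proof -
      have ins: "insert i x \<subseteq> S" using x i by auto
      have "(\<Sum>j\<in>x. vec (insert i x - {j})) = (\<Sum>j\<in>x. vec (insert i (x - {j})))"
        using i by (intro sum.cong refl) (auto simp: insert_Diff_if)
      moreover have "insert i x - {i} = x" using i by auto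
      ultimately show ?thesis using i fx by (simp add: app_cube_E[OF S ins])
    qed
    then have "app (cube_E S) (app (cube_F S) (vec x)) =
        of_nat (card (S - x)) *\<^sub>C vec x + (\<Sum>i\<in>S - x. \<Sum>j\<in>x. vec (insert i (x - {j})))"
      by (simp add: app_cube_F[OF S x] lin sum.distrib sum_const_scaleC)
    moreover have "app (cube_F S) (vec (x - {j})) = vec x + (\<Sum>i\<in>S - x. vec (insert i (x - {j})))"
      if j: "j \<in> x" for j
    proof -
      have del: "x - {j} \<subseteq> S" using x by auto
      have "S - (x - {j}) = insert j (S - x)" "insert j (x - {j}) = x" using x j by auto
      then show ?thesis using S j by (simp add: app_cube_F[OF S del])
    qed
    then have "app (cube_F S) (app (cube_E S) (vec x)) =
        of_nat (card x) *\<^sub>C vec x + (\<Sum>j\<in>x. \<Sum>i\<in>S - x. vec (insert i (x - {j})))"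
      by (simp add: app_cube_E[OF S x] lin sum.distrib sum_const_scaleC)
    moreover have "of_nat (card (S - x)) = (of_nat (card S) - of_nat (card x) :: complex)"
      using card_mono[OF S x] by (simp add: card_Diff_subset fx x of_nat_diff)
    ultimately show ?thesis
      by (simp add: app_cube_H[OF x] sum.swap[of _ x] scaleC_diff_left)
        (simp only: mult_2 scaleC_add_left minus_add_distrib, simp)
  qed
  show ?thesis
    unfolding sl2_triple_def
  proof (intro conjI lin_eqI_vec)
    fix x
    show "app (cube_H S * cube_E S - cube_E S * cube_H S) (vec x) = app (2 *\<^sub>C cube_E S) (vec x)"
      by (cases "x \<subseteq> S") (use HE in \<open>auto simp: out lin\<close>)
    show "app (cube_H S * cube_F S - cube_F S * cube_H S) (vec x) = app ((- 2) *\<^sub>C cube_F S) (vec x)"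
      by (cases "x \<subseteq> S") (use HF in \<open>auto simp: out lin\<close>)
    show "app (cube_E S * cube_F S - cube_F S * cube_E S) (vec x) = app (cube_H S) (vec x)"
      by (cases "x \<subseteq> S") (use EF in \<open>auto simp: out lin\<close>)
  qed
qed

lemma cube_rep:
  assumes "finite S"
  shows algebra_hom_cube_rep: "algebra_hom (cube_rep S)"
    and cube_rep_E: "cube_rep S usl2_E = cube_E S"
    and cube_rep_F: "cube_rep S usl2_F = cube_F S"
    and cube_rep_H: "cube_rep S usl2_H = cube_H S"
  using usl2_hom[OF sl2_triple_cube[OF assms]] by (simp_all add: cube_rep_def)

lemma cube_zero: "0 \<in> cube S"
  and cube_vec: "x \<subseteq> S \<Longrightarrow> vec x \<in> cube S"
  by (auto simp: cube_def)

lemma cube_add: "v \<in> cube S \<Longrightarrow> w \<in> cube S \<Longrightarrow> v + w \<in> cube S"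
  using keys_add[of v w] by (auto simp: cube_def)

lemma cube_scaleC: "v \<in> cube S \<Longrightarrow> c *\<^sub>C v \<in> cube S"
proof -
  have "Poly_Mapping.keys (c *\<^sub>C v) \<subseteq> Poly_Mapping.keys v"
    by (auto simp: in_keys_iff)
  then show "v \<in> cube S \<Longrightarrow> c *\<^sub>C v \<in> cube S" by (auto simp: cube_def)
qed

lemma cube_sum: "(\<And>i. i \<in> I \<Longrightarrow> g i \<in> cube S) \<Longrightarrow> (\<Sum>i\<in>I. g i) \<in> cube S"
  by (induction I rule: infinite_finite_induct) (auto simp: cube_zero cube_add)

lemma cube_invariant_if_vec:
  assumes "\<And>x. x \<subseteq> S \<Longrightarrow> app f (vec x) \<in> cube S" "v \<in> cube S"
  shows "app f v \<in> cube S"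
proof (rule vec_induct[of "\<lambda>v. app f v \<in> cube S" v])
  fix x assume "x \<in> Poly_Mapping.keys v"
  then have "x \<subseteq> S" using assms(2) by (auto simp: cube_def)
  then show "app f (vec x) \<in> cube S" by (rule assms(1))
qed (auto simp: clinear_zero[OF clinear_app] clinear_add[OF clinear_app]
    clinear_scaleC[OF clinear_app] cube_zero cube_add cube_scaleC)

lemma usl2_induct [case_names one E F H mult add scale]:
  assumes "P 1" "P usl2_E" "P usl2_F" "P usl2_H" "\<And>p q. P p \<Longrightarrow> P q \<Longrightarrow> P (p * q)"
    "\<And>p q. P p \<Longrightarrow> P q \<Longrightarrow> P (p + q)" "\<And>c p. P p \<Longrightarrow> P (c *\<^sub>C p)"
  shows "P u"
proof (induct u)
  fix p
  show "P (abs_usl2 p)"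
  proof (induction p rule: free_algebra_induct)
    case (gen g)
    then show ?case
      using assms(2-4) by (cases g) (simp_all add: usl2_E.abs_eq usl2_F.abs_eq usl2_H.abs_eq)
  qed (use assms in \<open>simp_all flip: one_usl2.abs_eq times_usl2.abs_eq plus_usl2.abs_eq scaleC_usl2.abs_eq\<close>)
qed

text \<open>\<open>cube S\<close> is a submodule of the ambient module.\<close>

lemma cube_rep_invariant:
  assumes S: "finite S" and v: "v \<in> cube S"
  shows "app (cube_rep S u) v \<in> cube S"
proof -
  note hom = algebra_hom_simps[OF algebra_hom_cube_rep[OF S]]
  have E: "app (cube_E S) (vec x) \<in> cube S" and F: "app (cube_F S) (vec x) \<in> cube S"
    and H: "app (cube_H S) (vec x) \<in> cube S" if "x \<subseteq> S" for x
    using that by (auto simp: app_cube_vec intro!: cube_sum cube_vec cube_scaleC cube_zero)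
  have "\<forall>v\<in>cube S. app (cube_rep S u) v \<in> cube S"
    by (induction u rule: usl2_induct)
      (auto simp: hom cube_rep_E cube_rep_F cube_rep_H S cube_add cube_scaleC
        intro: cube_invariant_if_vec E F H)
  then show ?thesis using v by blast
qed

lemma clinear_cube_split: "clinear (\<iota> x\<^sub>0)"
  unfolding cube_split_def by (rule clinear_lin_ext)

lemma cube_split_vec: "\<iota> x\<^sub>0 (vec x) = vec (x - x\<^sub>0) \<otimes> vec (x \<inter> x\<^sub>0)"
  by (simp add: cube_split_def)

lemma inj_cube_split: "inj (\<iota> x\<^sub>0)"
proof -
  define \<kappa> :: "('a set \<Rightarrow>\<^sub>0 complex) \<Rightarrow> ('a set \<Rightarrow>\<^sub>0 complex) \<Rightarrow> ('a set \<Rightarrow>\<^sub>0 complex)"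
    where "\<kappa> v w = lin_ext (\<lambda>x. lin_ext (\<lambda>y. vec (x \<union> y)) w) v" for v w
  have bilin: "cbilinear \<kappa>"
  proof (rule cbilinearI)
    show "clinear (\<lambda>v. \<kappa> v w)" for w
      unfolding \<kappa>_def by (rule clinear_lin_ext)
    show "clinear (\<kappa> v)" for v
      unfolding \<kappa>_def lin_ext_def[of _ v]
      by (rule clinearI) (simp_all add: clinear_add[OF clinear_lin_ext] clinear_scaleC[OF clinear_lin_ext]
          scaleC_add_right sum.distrib scaleC_sum_right mult.commute)
  qed
  have \<kappa>_vec: "\<kappa> (vec x) (vec y) = vec (x \<union> y)" for x y
    by (simp add: \<kappa>_def)
  have lin: "clinear (\<lambda>v. tensor_lift \<kappa> (\<iota> x\<^sub>0 v))"
    by (rule clinear_compose[OF clinear_tensor_lift[OF bilin] clinear_cube_split])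
  have "tensor_lift \<kappa> (\<iota> x\<^sub>0 (vec x)) = vec x" for x
  proof -
    have "(x - x\<^sub>0) \<union> (x \<inter> x\<^sub>0) = x" by auto
    then show ?thesis by (simp add: cube_split_vec tensor_lift_tens[OF bilin] \<kappa>_vec)
  qed
  then have "tensor_lift \<kappa> (\<iota> x\<^sub>0 v) = v" for v
    by (rule clinear_eq_on_vec[OF lin clinear_id])
  then show ?thesis by (rule inj_on_inverseI)
qed

lemma bij_betw_cube_split:
  assumes "x\<^sub>0 \<subseteq> \<Omega>"
  shows "bij_betw (\<iota> x\<^sub>0) (cube \<Omega>) (tensor_space (cube (\<Omega> - x\<^sub>0)) (cube x\<^sub>0))"
proof -
  let ?T = "tensor_space (cube (\<Omega> - x\<^sub>0)) (cube x\<^sub>0)"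
  note lin = clinear_zero[OF clinear_cube_split] clinear_add[OF clinear_cube_split]
    clinear_scaleC[OF clinear_cube_split]
  have T0: "0 \<in> ?T"
    using tensor_space.tens[OF cube_zero cube_zero, of "\<Omega> - x\<^sub>0" x\<^sub>0]
      tens_scaleC_left[of 0 "0 :: 'a set \<Rightarrow>\<^sub>0 complex" "0 :: 'a set \<Rightarrow>\<^sub>0 complex"] by simp
  have Tc: "c *\<^sub>C t \<in> ?T" if "t \<in> ?T" for c t
    using that by induction
      (auto simp: scaleC_add_right cube_scaleC tensor_space.add tensor_space.tens simp flip: tens_scaleC_left)
  have "\<iota> x\<^sub>0 v \<in> ?T" if "v \<in> cube \<Omega>" for v
  proof (rule vec_induct[of "\<lambda>v. \<iota> x\<^sub>0 v \<in> ?T" v])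
    fix x assume "x \<in> Poly_Mapping.keys v"
    then have "x \<subseteq> \<Omega>" using that by (auto simp: cube_def)
    then show "\<iota> x\<^sub>0 (vec x) \<in> ?T"
      by (auto simp: cube_split_vec intro!: tensor_space.tens cube_vec)
  qed (simp_all add: lin T0 Tc tensor_space.add)
  moreover have "t \<in> \<iota> x\<^sub>0 ` cube \<Omega>" if "t \<in> ?T" for t
    using that
  proof induction
    case (tens v w)
    have vecs: "vec x \<otimes> vec y \<in> \<iota> x\<^sub>0 ` cube \<Omega>" if "x \<subseteq> \<Omega> - x\<^sub>0" "y \<subseteq> x\<^sub>0" for x y
    proof
      have "(x \<union> y) - x\<^sub>0 = x" "(x \<union> y) \<inter> x\<^sub>0 = y" using that by auto
      then show "vec x \<otimes> vec y = \<iota> x\<^sub>0 (vec (x \<union> y))" by (simp add: cube_split_vec)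
      show "vec (x \<union> y) \<in> cube \<Omega>" using that assms by (auto intro!: cube_vec)
    qed
    have im0: "0 \<in> \<iota> x\<^sub>0 ` cube \<Omega>" by (rule image_eqI[OF _ cube_zero]) (simp add: lin)
    have imadd: "s + t \<in> \<iota> x\<^sub>0 ` cube \<Omega>" if "s \<in> \<iota> x\<^sub>0 ` cube \<Omega>" "t \<in> \<iota> x\<^sub>0 ` cube \<Omega>" for s t
      using that by (auto simp flip: lin intro!: imageI cube_add)
    have imsc: "c *\<^sub>C t \<in> \<iota> x\<^sub>0 ` cube \<Omega>" if "t \<in> \<iota> x\<^sub>0 ` cube \<Omega>" for c t
      using that by (auto simp flip: lin intro!: imageI cube_scaleC)
    have z: "0 \<otimes> w = 0" "v \<otimes> 0 = 0" for v w :: "'a set \<Rightarrow>\<^sub>0 complex"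
      using tens_scaleC_left[of 0 0 w] tens_scaleC_right[of v 0 0] by simp_all
    have "vec x \<otimes> w \<in> \<iota> x\<^sub>0 ` cube \<Omega>" if "x \<subseteq> \<Omega> - x\<^sub>0" for x
      using tens(2) that
      by (intro vec_induct[of "\<lambda>w. vec x \<otimes> w \<in> \<iota> x\<^sub>0 ` cube \<Omega>" w])
        (auto simp: cube_def[of x\<^sub>0] z im0 tens_add_right tens_scaleC_right intro!: imadd imsc vecs)
    then show ?case
      using tens(1)
      by (intro vec_induct[of "\<lambda>v. v \<otimes> w \<in> \<iota> x\<^sub>0 ` cube \<Omega>" v])
        (auto simp: cube_def[of "\<Omega> - x\<^sub>0"] z im0 tens_add_left tens_scaleC_left intro!: imadd imsc)
  next
    case (add s t)
    then show ?case by (auto simp flip: lin intro!: imageI cube_add)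
  qed
  ultimately show ?thesis
    using inj_cube_split[of x\<^sub>0] by (auto simp: bij_betw_def intro: inj_on_subset)
qed

text \<open>The action on \<open>cube \<Omega>\<close> is the one on the tensor product transported along \<open>\<iota> x\<^sub>0\<close>.\<close>

lemma usl2_tensor_act:
  assumes \<Omega>: "finite \<Omega>" "x\<^sub>0 \<subseteq> \<Omega>" and v: "v \<in> cube \<Omega>"
  shows usl2_tensor_act_in_cube: "usl2_tensor_act \<Omega> x\<^sub>0 t v \<in> cube \<Omega>"
    and cube_split_usl2_tensor_act: "\<iota> x\<^sub>0 (usl2_tensor_act \<Omega> x\<^sub>0 t v) =
      app (tensor_rep (cube_rep (\<Omega> - x\<^sub>0)) (cube_rep x\<^sub>0) t) (\<iota> x\<^sub>0 v)"
proof -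
  let ?T = "tensor_space (cube (\<Omega> - x\<^sub>0)) (cube x\<^sub>0)"
  let ?\<rho> = "tensor_rep (cube_rep (\<Omega> - x\<^sub>0)) (cube_rep x\<^sub>0)"
  have fin: "finite (\<Omega> - x\<^sub>0)" "finite x\<^sub>0" using \<Omega> by (auto intro: finite_subset)
  note homs = fin[THEN algebra_hom_cube_rep]
  note hom = algebra_hom_tensor_rep[OF homs]
  have inv: "app (?\<rho> t) s \<in> ?T" if "s \<in> ?T" for s
    using that
  proof (induction t arbitrary: s rule: tensor_induct)
    case (tens a b)
    from tens show ?case
      by induction
        (auto simp: tensor_rep_tens homs[THEN algebra_hom_clinear] clinear_add[OF clinear_app]
          intro!: tensor_space.intros cube_rep_invariant fin)
  next
    case (add t t')
    then show ?case by (auto simp: algebra_hom_simps[OF hom] intro!: tensor_space.add)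
  qed
  note bij = bij_betw_cube_split[OF \<Omega>(2)]
  have "app (?\<rho> t) (\<iota> x\<^sub>0 v) \<in> \<iota> x\<^sub>0 ` cube \<Omega>"
    using inv[of "\<iota> x\<^sub>0 v"] bij v by (auto simp: bij_betw_def)
  then show "usl2_tensor_act \<Omega> x\<^sub>0 t v \<in> cube \<Omega>"
    "\<iota> x\<^sub>0 (usl2_tensor_act \<Omega> x\<^sub>0 t v) = app (?\<rho> t) (\<iota> x\<^sub>0 v)"
    unfolding usl2_tensor_act_def by (rule inv_into_into, rule f_inv_into_f)
qed

lemma hahn_act_module:
  assumes \<Omega>: "finite \<Omega>" "x\<^sub>0 \<subseteq> \<Omega>" and v: "v \<in> cube \<Omega>" "w \<in> cube \<Omega>"
  shows "hahn_act \<Omega> x\<^sub>0 h v \<in> cube \<Omega>"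
    and "hahn_act \<Omega> x\<^sub>0 h (v + w) = hahn_act \<Omega> x\<^sub>0 h v + hahn_act \<Omega> x\<^sub>0 h w"
    and "hahn_act \<Omega> x\<^sub>0 h (c *\<^sub>C v) = c *\<^sub>C hahn_act \<Omega> x\<^sub>0 h v"
    and "hahn_act \<Omega> x\<^sub>0 (h + k) v = hahn_act \<Omega> x\<^sub>0 h v + hahn_act \<Omega> x\<^sub>0 k v"
    and "hahn_act \<Omega> x\<^sub>0 (c *\<^sub>C h) v = c *\<^sub>C hahn_act \<Omega> x\<^sub>0 h v"
    and "hahn_act \<Omega> x\<^sub>0 (h * k) v = hahn_act \<Omega> x\<^sub>0 h (hahn_act \<Omega> x\<^sub>0 k v)"
    and "hahn_act \<Omega> x\<^sub>0 1 v = v"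
proof -
  have fin: "finite (\<Omega> - x\<^sub>0)" "finite x\<^sub>0" using \<Omega> by (auto intro: finite_subset)
  note hom = algebra_hom_simps[OF algebra_hom_hahn_natural]
    algebra_hom_simps[OF algebra_hom_tensor_rep[OF fin[THEN algebra_hom_cube_rep]]]
  note lin = clinear_add[OF clinear_cube_split] clinear_scaleC[OF clinear_cube_split]
    clinear_add[OF clinear_app] clinear_scaleC[OF clinear_app]
  have split: "\<iota> x\<^sub>0 (hahn_act \<Omega> x\<^sub>0 h v) =
      app (tensor_rep (cube_rep (\<Omega> - x\<^sub>0)) (cube_rep x\<^sub>0) (\<natural> h)) (\<iota> x\<^sub>0 v)"
    if "v \<in> cube \<Omega>" for h v
    unfolding hahn_act_def by (rule cube_split_usl2_tensor_act[OF \<Omega> that])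
  have cube: "hahn_act \<Omega> x\<^sub>0 h v \<in> cube \<Omega>" if "v \<in> cube \<Omega>" for h v
    unfolding hahn_act_def by (rule usl2_tensor_act_in_cube[OF \<Omega> that])
  show "hahn_act \<Omega> x\<^sub>0 h v \<in> cube \<Omega>" by (rule cube[OF v(1)])
  note eqI = injD[OF inj_cube_split[of x\<^sub>0]]
  show "hahn_act \<Omega> x\<^sub>0 h (v + w) = hahn_act \<Omega> x\<^sub>0 h v + hahn_act \<Omega> x\<^sub>0 h w"
    by (rule eqI) (simp add: split v cube_add lin)
  show "hahn_act \<Omega> x\<^sub>0 h (c *\<^sub>C v) = c *\<^sub>C hahn_act \<Omega> x\<^sub>0 h v"
    by (rule eqI) (simp add: split v cube_scaleC lin)
  show "hahn_act \<Omega> x\<^sub>0 (h + k) v = hahn_act \<Omega> x\<^sub>0 h v + hahn_act \<Omega> x\<^sub>0 k v"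
    by (rule eqI) (simp add: split v hom lin)
  show "hahn_act \<Omega> x\<^sub>0 (c *\<^sub>C h) v = c *\<^sub>C hahn_act \<Omega> x\<^sub>0 h v"
    by (rule eqI) (simp add: split v hom lin)
  show "hahn_act \<Omega> x\<^sub>0 (h * k) v = hahn_act \<Omega> x\<^sub>0 h (hahn_act \<Omega> x\<^sub>0 k v)"
    by (rule eqI) (simp add: split v cube hom)
  show "hahn_act \<Omega> x\<^sub>0 1 v = v"
    by (rule eqI) (simp add: split v hom)
qed

end

theory Submission
  imports Defs
begin

text \<open>The isomorphism \<open>\<iota> x\<^sub>0\<close> intertwines the action of \<open>U(sl\<^sub>2)\<close> on \<open>\<complex>\<^bsup>2^\<Omega>\<^esup>\<close> with its action through
  \<open>\<Delta>\<close> on the tensor product: adding or removing one element of \<open>x\<close> happens either outside or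
  inside \<open>x\<^sub>0\<close>. Hence \<open>B\<close> acts as half the Casimir element of the single module on \<open>\<complex>\<^bsup>2^\<Omega>\<^esup>\<close>,
  whose \<open>EF\<close> and \<open>FE\<close> each contribute all exchanges of one element of \<open>x\<close> for one outside \<open>x\<close>.\<close>

lemma clinear_tens_left: "clinear (\<lambda>v. v \<otimes> w)"
  and clinear_tens_right: "clinear (\<lambda>w. v \<otimes> w)"
  using cbilinear_tens by (auto simp: cbilinear_def)

text \<open>The intertwining relations below are only available on subsets of
  \<open>\<Omega>\<close>: for a basis vector outside the cube, \<open>cube_E \<Omega>\<close> gives
  0, while \<open>E\<close> on the second tensor factor still acts on
  \<open>x \<inter> x\<^sub>0\<close>.\<close>

lemma clinear_eq_on_cube:
  assumes "clinear f" "clinear g" "\<And>x. x \<subseteq> S \<Longrightarrow> f (vec x) = g (vec x)" "v \<in> cube S"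
  shows "f v = g v"
  by (rule clinear_eq_on_vec[OF assms(1,2)]) (use assms(3,4) in \<open>auto simp: cube_def\<close>)

context
  fixes \<Omega> x\<^sub>0 :: "'a set"
  assumes fin: "finite \<Omega>" and sub: "x\<^sub>0 \<subseteq> \<Omega>"
begin

private lemma fin_parts: "finite (\<Omega> - x\<^sub>0)" "finite x\<^sub>0"
  using fin sub by (auto intro: finite_subset)

private lemma card_parts: "card \<Omega> = card (\<Omega> - x\<^sub>0) + card x\<^sub>0"
  using card_Int_Diff[OF fin, of x\<^sub>0] unfolding Int_absorb1[OF sub] by (rule trans) (rule add.commute)

private abbreviation (input) "\<rho> \<equiv> tensor_rep (cube_rep (\<Omega> - x\<^sub>0)) (cube_rep x\<^sub>0)"

private lemmas homs = fin_parts[THEN algebra_hom_cube_rep]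
private lemmas \<rho>_simps = algebra_hom_simps[OF algebra_hom_tensor_rep[OF homs]]
  tensor_rep_tens[OF homs[THEN algebra_hom_clinear]]

text \<open>Deleting an element outside \<open>x\<^sub>0\<close> alters only the first tensor factor
  and deleting one inside alters only the second, so the sum over \<open>x\<close> falls into the
  actions of \<open>E \<otimes> 1\<close> and \<open>1 \<otimes> E\<close>.\<close>

lemma cube_split_E:
  assumes x: "x \<subseteq> \<Omega>"
  shows "app (\<rho> (\<Delta> usl2_E)) (\<iota> x\<^sub>0 (vec x)) = \<iota> x\<^sub>0 (app (cube_E \<Omega>) (vec x))"
proof -
  have parts: "x - x\<^sub>0 \<subseteq> \<Omega> - x\<^sub>0" "x \<inter> x\<^sub>0 \<subseteq> x\<^sub>0" and finx: "finite x"
    using x fin by (auto intro: finite_subset)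
  have "(\<Sum>i\<in>x. \<iota> x\<^sub>0 (vec (x - {i}))) =
      (\<Sum>i\<in>x - x\<^sub>0. \<iota> x\<^sub>0 (vec (x - {i}))) + (\<Sum>i\<in>x \<inter> x\<^sub>0. \<iota> x\<^sub>0 (vec (x - {i})))"
    by (simp add: sum.Int_Diff[OF finx, of _ x\<^sub>0] add.commute)
  \<comment> \<open>The congruence rules leave set identities: for
    \<open>i \<notin> x\<^sub>0\<close>, \<open>x - {i} - x\<^sub>0 = x - x\<^sub>0 - {i}\<close>
    and \<open>(x - {i}) \<inter> x\<^sub>0 = x \<inter> x\<^sub>0\<close>.\<close>
  also have "(\<Sum>i\<in>x - x\<^sub>0. \<iota> x\<^sub>0 (vec (x - {i}))) = (\<Sum>i\<in>x - x\<^sub>0. vec (x - x\<^sub>0 - {i}) \<otimes> vec (x \<inter> x\<^sub>0))"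
    by (intro sum.cong refl)
      (auto simp: cube_split_vec intro!: arg_cong2[of _ _ _ _ "(\<otimes>)"] arg_cong[of _ _ vec])
  also have "(\<Sum>i\<in>x \<inter> x\<^sub>0. \<iota> x\<^sub>0 (vec (x - {i}))) = (\<Sum>i\<in>x \<inter> x\<^sub>0. vec (x - x\<^sub>0) \<otimes> vec (x \<inter> x\<^sub>0 - {i}))"
    by (intro sum.cong refl)
      (auto simp: cube_split_vec intro!: arg_cong2[of _ _ _ _ "(\<otimes>)"] arg_cong[of _ _ vec])
  finally show ?thesis
    by (simp add: comult_E \<rho>_simps homs[THEN algebra_hom_one] cube_rep_E fin_parts cube_split_vec[of _ x]
        app_cube_E[OF fin x] app_cube_E[OF fin_parts(1) parts(1)] app_cube_E[OF fin_parts(2) parts(2)]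
        clinear_sum[OF clinear_cube_split] clinear_sum[OF clinear_tens_left]
        clinear_sum[OF clinear_tens_right])
qed

lemma cube_split_F:
  assumes x: "x \<subseteq> \<Omega>"
  shows "app (\<rho> (\<Delta> usl2_F)) (\<iota> x\<^sub>0 (vec x)) = \<iota> x\<^sub>0 (app (cube_F \<Omega>) (vec x))"
proof -
  have parts: "x - x\<^sub>0 \<subseteq> \<Omega> - x\<^sub>0" "x \<inter> x\<^sub>0 \<subseteq> x\<^sub>0"
    using x by auto
  \<comment> \<open>These are the complements of the two parts of \<open>x\<close>, each within its
    own ground set, in the form in which \<open>app_cube_F\<close> produces them on the
    factors.\<close>
  let ?O = "\<Omega> - x\<^sub>0 - (x - x\<^sub>0)" and ?I = "x\<^sub>0 - x \<inter> x\<^sub>0"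
  have decomp: "\<Omega> - x = ?O \<union> ?I" using sub by auto
  have "(\<Sum>i\<in>\<Omega> - x. \<iota> x\<^sub>0 (vec (insert i x))) =
      (\<Sum>i\<in>?O. \<iota> x\<^sub>0 (vec (insert i x))) + (\<Sum>i\<in>?I. \<iota> x\<^sub>0 (vec (insert i x)))"
    unfolding decomp using fin fin_parts by (intro sum.union_disjoint) auto
  also have "(\<Sum>i\<in>?O. \<iota> x\<^sub>0 (vec (insert i x))) = (\<Sum>i\<in>?O. vec (insert i (x - x\<^sub>0)) \<otimes> vec (x \<inter> x\<^sub>0))"
    by (intro sum.cong refl)
      (auto simp: cube_split_vec intro!: arg_cong2[of _ _ _ _ "(\<otimes>)"] arg_cong[of _ _ vec])
  also have "(\<Sum>i\<in>?I. \<iota> x\<^sub>0 (vec (insert i x))) = (\<Sum>i\<in>?I. vec (x - x\<^sub>0) \<otimes> vec (insert i (x \<inter> x\<^sub>0)))"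
    by (intro sum.cong refl)
      (auto simp: cube_split_vec intro!: arg_cong2[of _ _ _ _ "(\<otimes>)"] arg_cong[of _ _ vec])
  finally show ?thesis
    by (simp add: comult_F \<rho>_simps homs[THEN algebra_hom_one] cube_rep_F fin_parts cube_split_vec[of _ x]
        app_cube_F[OF fin x] app_cube_F[OF fin_parts(1) parts(1)] app_cube_F[OF fin_parts(2) parts(2)]
        clinear_sum[OF clinear_cube_split] clinear_sum[OF clinear_tens_left]
        clinear_sum[OF clinear_tens_right])
qed

text \<open>Both \<open>card \<Omega>\<close> and \<open>card x\<close> split along
  \<open>x\<^sub>0\<close>, so the weight of \<open>x\<close> is the sum of the weights of its two
  parts.\<close>

lemma cube_split_H:
  assumes x: "x \<subseteq> \<Omega>"
  shows "app (\<rho> (\<Delta> usl2_H)) (\<iota> x\<^sub>0 (vec x)) = \<iota> x\<^sub>0 (app (cube_H \<Omega>) (vec x))"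
proof -
  have parts: "x - x\<^sub>0 \<subseteq> \<Omega> - x\<^sub>0" "x \<inter> x\<^sub>0 \<subseteq> x\<^sub>0" and finx: "finite x"
    using x fin by (auto intro: finite_subset)
  have "card x = card (x - x\<^sub>0) + card (x \<inter> x\<^sub>0)"
    using card_Int_Diff[OF finx, of x\<^sub>0] by simp
  with card_parts have "(of_nat (card \<Omega>) - 2 * of_nat (card x) :: complex) =
      (of_nat (card (\<Omega> - x\<^sub>0)) - 2 * of_nat (card (x - x\<^sub>0))) +
      (of_nat (card x\<^sub>0) - 2 * of_nat (card (x \<inter> x\<^sub>0)))"
    by simp
  then show ?thesis
    by (simp only: app_cube_H[OF x] clinear_scaleC[OF clinear_cube_split]
        clinear_add[OF clinear_cube_split] scaleC_add_left)
      (simp add: comult_H \<rho>_simps homs[THEN algebra_hom_one] cube_rep_H fin_parts cube_split_vec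
        app_cube_H[OF parts(1)] app_cube_H[OF parts(2)] tens_scaleC_left tens_scaleC_right)
qed

text \<open>Intertwining is preserved by products, sums and scalar multiples because
  \<open>\<Delta>\<close> and the representations are algebra homomorphisms, so it suffices to check
  the three generators, and these only on basis vectors.\<close>

lemma cube_split_comult:
  assumes "v \<in> cube \<Omega>"
  shows "app (\<rho> (\<Delta> u)) (\<iota> x\<^sub>0 v) = \<iota> x\<^sub>0 (app (cube_rep \<Omega> u) v)"
proof -
  have on_vec: "app f (\<iota> x\<^sub>0 v) = \<iota> x\<^sub>0 (app g v)"
    if "\<And>x. x \<subseteq> \<Omega> \<Longrightarrow> app f (\<iota> x\<^sub>0 (vec x)) = \<iota> x\<^sub>0 (app g (vec x))" "v \<in> cube \<Omega>" for f g v
    by (rule clinear_eq_on_cube[where f = "\<lambda>v. app f (\<iota> x\<^sub>0 v)" and g = "\<lambda>v. \<iota> x\<^sub>0 (app g v)",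
          OF clinear_compose[OF clinear_app clinear_cube_split]
          clinear_compose[OF clinear_cube_split clinear_app] that])
  show ?thesis
    using assms
  \<comment> \<open>In the product case the hypothesis for the left factor is applied to the image
    of \<open>v\<close> under the right one, which stays in the cube by
    \<open>cube_rep_invariant\<close>.\<close>
  proof (induction u arbitrary: v rule: usl2_induct)
    case E
    then show ?case unfolding cube_rep_E[OF fin] by (rule on_vec[rotated]) (rule cube_split_E)
  next
    case F
    then show ?case unfolding cube_rep_F[OF fin] by (rule on_vec[rotated]) (rule cube_split_F)
  next
    case H
    then show ?case unfolding cube_rep_H[OF fin] by (rule on_vec[rotated]) (rule cube_split_H)
  qed (simp_all add: \<rho>_simps algebra_hom_simps[OF algebra_hom_comult]
    algebra_hom_simps[OF algebra_hom_cube_rep[OF fin]] cube_rep_invariant[OF fin]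
    clinear_add[OF clinear_cube_split] clinear_scaleC[OF clinear_cube_split])
qed

text \<open>\<open>\<iota>\<close> sends a subset to a pure tensor of two weight vectors, and
  \<open>A\<close> scales it by a quarter of the difference of their weights.\<close>

lemma hahn_act_A:
  assumes x: "x \<subseteq> \<Omega>"
  shows "hahn_act \<Omega> x\<^sub>0 hahn_A (vec x) =
    (of_nat (card \<Omega>) / 4 - of_nat (card (x\<^sub>0 - x) + card (x - x\<^sub>0)) / 2) *\<^sub>C vec x"
proof -
  have parts: "x - x\<^sub>0 \<subseteq> \<Omega> - x\<^sub>0" "x \<inter> x\<^sub>0 \<subseteq> x\<^sub>0"
    using x by auto
  have "card x\<^sub>0 = card (x\<^sub>0 - x) + card (x \<inter> x\<^sub>0)"
    using card_Int_Diff[OF fin_parts(2), of x] by (simp add: Int_commute)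
  \<comment> \<open>Substituting \<open>card (x \<inter> x\<^sub>0) = card x\<^sub>0 - card
    (x\<^sub>0 - x)\<close> turns the weight difference into \<open>card \<Omega>\<close> minus
    twice the size of the symmetric difference of \<open>x\<close> and
    \<open>x\<^sub>0\<close>.\<close>
  with card_parts have coeff: "of_nat (card \<Omega>) / 4 - of_nat (card (x\<^sub>0 - x) + card (x - x\<^sub>0)) / 2 =
      1 / 4 * ((of_nat (card (\<Omega> - x\<^sub>0)) - 2 * of_nat (card (x - x\<^sub>0))) -
      (of_nat (card x\<^sub>0) - 2 * of_nat (card (x \<inter> x\<^sub>0))) :: complex)"
    by (simp add: field_simps)
  have "\<iota> x\<^sub>0 (hahn_act \<Omega> x\<^sub>0 hahn_A (vec x)) = app (\<rho> (\<natural> hahn_A)) (\<iota> x\<^sub>0 (vec x))"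
    unfolding hahn_act_def by (rule cube_split_usl2_tensor_act[OF fin sub cube_vec[OF x]])
  also have "\<dots> = \<iota> x\<^sub>0 ((of_nat (card \<Omega>) / 4 - of_nat (card (x\<^sub>0 - x) + card (x - x\<^sub>0)) / 2) *\<^sub>C vec x)"
    unfolding coeff clinear_scaleC[OF clinear_cube_split] scaleC_scaleC[symmetric]
    by (simp del: scaleC_scaleC add: scaleC_diff_left tens_diff_left tens_diff_right hahn_natural_A
        \<rho>_simps homs[THEN algebra_hom_one] cube_rep_H fin_parts cube_split_vec
        app_cube_H[OF parts(1)] app_cube_H[OF parts(2)] tens_scaleC_left tens_scaleC_right)
  finally show ?thesis by (rule injD[OF inj_cube_split])
qed

text \<open>Here the dependence on \<open>x\<^sub>0\<close> disappears: \<open>B\<close> maps to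
  half of \<open>\<Delta> casimir\<close>, and the intertwining moves this to the undivided cube,
  where injectivity of \<open>\<iota>\<close> finishes.\<close>

lemma hahn_act_B:
  assumes v: "v \<in> cube \<Omega>"
  shows "hahn_act \<Omega> x\<^sub>0 hahn_B v = (1/2) *\<^sub>C app (cube_rep \<Omega> casimir) v"
proof -
  have "\<iota> x\<^sub>0 (hahn_act \<Omega> x\<^sub>0 hahn_B v) = app (\<rho> (\<natural> hahn_B)) (\<iota> x\<^sub>0 v)"
    unfolding hahn_act_def by (rule cube_split_usl2_tensor_act[OF fin sub v])
  also have "\<dots> = \<iota> x\<^sub>0 ((1/2) *\<^sub>C app (cube_rep \<Omega> casimir) v)"
    by (simp add: hahn_natural_B \<rho>_simps cube_split_comult[OF v] clinear_scaleC[OF clinear_cube_split])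
  finally show ?thesis by (rule injD[OF inj_cube_split])
qed

end

text \<open>Equal cardinalities and an intersection smaller by one force \<open>x - y\<close> and
  \<open>y - x\<close> to be singletons \<open>{j}\<close> and \<open>{i}\<close>. The integers
  matter for \<open>x = {}\<close>: with truncated subtraction \<open>y = {}\<close> would qualify,
  although there is nothing to exchange.\<close>

lemma exchanges:
  assumes S: "finite S" and x: "x \<subseteq> S"
  shows "{y. y \<in> Pow S \<and> card y = card x \<and> int (card (x \<inter> y)) = int (card x) - 1} =
    (\<lambda>(i, j). insert i (x - {j})) ` ((S - x) \<times> x)" (is "?L = ?R")
proof (intro equalityI subsetI)
  have finx: "finite x" using S x by (rule finite_subset[rotated])
  fix y assume "y \<in> ?L"
  then have y: "y \<subseteq> S" "card y = card x" "int (card (x \<inter> y)) = int (card x) - 1" by auto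
  have finy: "finite y" using S y(1) by (rule finite_subset[rotated])
  have "card (x - y) = 1" "card (y - x) = 1"
    using card_Int_Diff[OF finx, of y] card_Int_Diff[OF finy, of x] y(2,3) by (auto simp: Int_commute)
  then obtain i j where "x - y = {j}" "y - x = {i}" by (auto simp: card_1_singleton_iff)
  then have "y = insert i (x - {j})" "i \<in> S - x" "j \<in> x" using y(1) by auto
  then show "y \<in> ?R" by auto
next
  have finx: "finite x" using S x by (rule finite_subset[rotated])
  fix y assume "y \<in> ?R"
  then obtain i j where ij: "i \<in> S" "i \<notin> x" "j \<in> x" "y = insert i (x - {j})" by auto
  then have "x \<inter> y = x - {j}" by auto
  moreover have "card x = card (x - {j}) + 1" using card_Suc_Diff1[OF finx ij(3)] by simp
  ultimately show "y \<in> ?L" using ij x finx by (auto simp del: card_Diff_insert)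
qed

text \<open>The pair is recovered from the exchanged set \<open>y\<close> as the sole elements of
  \<open>y - x\<close> and \<open>x - y\<close>, so a double sum over pairs counts every
  \<open>y\<close> once.\<close>

lemma inj_on_exchange: "inj_on (\<lambda>(i, j). insert i (x - {j})) ((S - x) \<times> x)"
proof (rule inj_onI, clarify)
  fix i j i' j'
  assume *: "i \<notin> x" "j \<in> x" "i' \<notin> x" "j' \<in> x" "insert i (x - {j}) = insert i' (x - {j'})"
  then have "insert i (x - {j}) - x = insert i' (x - {j'}) - x"
    "x - insert i (x - {j}) = x - insert i' (x - {j'})" by simp_all
  moreover have "insert i (x - {j}) - x = {i}" "insert i' (x - {j'}) - x = {i'}"
    "x - insert i (x - {j}) = {j}" "x - insert i' (x - {j'}) = {j'}" using * by auto
  ultimately show "i = i' \<and> j = j'" by simp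
qed

text \<open>After \<open>F\<close> adds some \<open>i\<close>, \<open>E\<close> either removes it
  again, giving \<open>x\<close> once for each element outside \<open>x\<close>, or removes some
  \<open>j \<in> x\<close>, giving an exchange.\<close>

lemma app_cube_EF:
  assumes S: "finite S" and x: "x \<subseteq> S"
  shows "app (cube_E S) (app (cube_F S) (vec x)) = of_nat (card (S - x)) *\<^sub>C vec x +
    (\<Sum>y | y \<in> Pow S \<and> card y = card x \<and> int (card (x \<inter> y)) = int (card x) - 1. vec y)"
proof -
  have finx: "finite x" using S x by (rule finite_subset[rotated])
  have "app (cube_E S) (vec (insert i x)) = vec x + (\<Sum>j\<in>x. vec (insert i (x - {j})))"
    if i: "i \<in> S - x" for i
  proof -
    have ins: "insert i x \<subseteq> S" using x i by auto
    have "(\<Sum>j\<in>x. vec (insert i x - {j})) = (\<Sum>j\<in>x. vec (insert i (x - {j})))"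
      using i by (intro sum.cong refl) (auto simp: insert_Diff_if)
    moreover have "insert i x - {i} = x" using i by auto
    ultimately show ?thesis using i finx by (simp add: app_cube_E[OF S ins])
  qed
  then have "app (cube_E S) (app (cube_F S) (vec x)) =
      of_nat (card (S - x)) *\<^sub>C vec x + (\<Sum>i\<in>S - x. \<Sum>j\<in>x. vec (insert i (x - {j})))"
    by (simp add: app_cube_F[OF S x] clinear_sum[OF clinear_app] sum.distrib sum_const_scaleC)
  also have "(\<Sum>i\<in>S - x. \<Sum>j\<in>x. vec (insert i (x - {j}))) =
      (\<Sum>y | y \<in> Pow S \<and> card y = card x \<and> int (card (x \<inter> y)) = int (card x) - 1. vec y)"
    unfolding exchanges[OF S x] sum.reindex[OF inj_on_exchange]
    by (simp add: sum.cartesian_product case_prod_unfold)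
  finally show ?thesis .
qed

lemma half_casimir_cube:
  assumes S: "finite S" and x: "x \<subseteq> S"
  shows "(1/2) *\<^sub>C app (cube_rep S casimir) (vec x) =
    (of_nat (card S) / 2 + (of_nat (card S) - 2 * of_nat (card x)) ^ 2 / 4) *\<^sub>C vec x +
    (\<Sum>y | y \<in> Pow S \<and> card y = card x \<and> int (card (x \<inter> y)) = int (card x) - 1. vec y)"
proof -
  have finx: "finite x" using S x by (rule finite_subset[rotated])
  let ?h = "of_nat (card S) - 2 * of_nat (card x) :: complex"
  let ?s = "\<Sum>y | y \<in> Pow S \<and> card y = card x \<and> int (card (x \<inter> y)) = int (card x) - 1. vec y"
  have c: "of_nat (card (S - x)) = (of_nat (card S) - of_nat (card x) :: complex)"
    using card_mono[OF S x] by (simp add: card_Diff_subset finx x of_nat_diff)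
  \<comment> \<open>With \<open>FE = EF - H\<close> the Casimir element becomes
    \<open>2 EF - H + H^2 / 2\<close>, so only the action of \<open>EF\<close> has to be
    known.\<close>
  have "cube_F S * cube_E S = cube_E S * cube_F S - cube_H S"
    using sl2_triple_cube[OF S] by (simp add: sl2_triple_def algebra_simps)
  then have "cube_rep S casimir =
      2 *\<^sub>C (cube_E S * cube_F S) - cube_H S + (1/2) *\<^sub>C (cube_H S * cube_H S)"
    using scaleC_add_left[of 1 1 "cube_E S * cube_F S"]
    by (simp add: casimir_def power2_eq_square algebra_hom_simps[OF algebra_hom_cube_rep[OF S]]
        cube_rep_E cube_rep_F cube_rep_H S)
  then have "(1/2) *\<^sub>C app (cube_rep S casimir) (vec x) =
      (1/2) *\<^sub>C (2 *\<^sub>C (of_nat (card (S - x)) *\<^sub>C vec x + ?s) - ?h *\<^sub>C vec x + (1/2) *\<^sub>C ((?h * ?h) *\<^sub>C vec x))"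
    by (simp only: app_simps app_cube_EF[OF S x] app_cube_H[OF x] clinear_scaleC[OF clinear_app] scaleC_scaleC)
  also have "(1/2) *\<^sub>C (2 *\<^sub>C (a *\<^sub>C vec x + ?s) - h *\<^sub>C vec x + (1/2) *\<^sub>C ((h * h) *\<^sub>C vec x)) =
      (a - h / 2 + h * h / 4) *\<^sub>C vec x + ?s" for a h
    by (simp add: scaleC_add_right scaleC_diff_right scaleC_add_left scaleC_diff_left)
  \<comment> \<open>Writing \<open>n = card S\<close> and \<open>k = card x\<close>, this is
    \<open>(n - k) - (n - 2 k) / 2 = n / 2\<close>; the quadratic term is unchanged.\<close>
  also have "of_nat (card (S - x)) - ?h / 2 + ?h * ?h / 4 = of_nat (card S) / 2 + ?h ^ 2 / 4"
    unfolding c by (simp add: power2_eq_square field_simps)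
  finally show ?thesis .
qed

theorem theorem5p8:
  fixes \<Omega> x\<^sub>0 :: "'a set" and D :: nat
  assumes "finite \<Omega>" and "card \<Omega> = D" and "x\<^sub>0 \<in> Pow \<Omega>"
  shows "\<forall>x\<in>Pow \<Omega>.
      hahn_act \<Omega> x\<^sub>0 hahn_A (vec x) =
        (of_nat D / 4 - of_nat (card (x\<^sub>0 - x) + card (x - x\<^sub>0)) / 2) *\<^sub>C vec x \<and>
      hahn_act \<Omega> x\<^sub>0 hahn_B (vec x) =
        (of_nat D / 2 + (of_nat D - 2 * of_nat (card x)) ^ 2 / 4) *\<^sub>C vec x +
        (\<Sum>y | y \<in> Pow \<Omega> \<and> card y = card x \<and> int (card (x \<inter> y)) = int (card x) - 1. vec y)"
proof (intro ballI conjI)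
  fix x assume "x \<in> Pow \<Omega>"
  then have x: "x \<subseteq> \<Omega>" and x\<^sub>0: "x\<^sub>0 \<subseteq> \<Omega>" using assms(3) by auto
  show "hahn_act \<Omega> x\<^sub>0 hahn_A (vec x) =
      (of_nat D / 4 - of_nat (card (x\<^sub>0 - x) + card (x - x\<^sub>0)) / 2) *\<^sub>C vec x"
    using hahn_act_A[OF assms(1) x\<^sub>0 x] by (simp only: assms(2))
  show "hahn_act \<Omega> x\<^sub>0 hahn_B (vec x) =
      (of_nat D / 2 + (of_nat D - 2 * of_nat (card x)) ^ 2 / 4) *\<^sub>C vec x +
      (\<Sum>y | y \<in> Pow \<Omega> \<and> card y = card x \<and> int (card (x \<inter> y)) = int (card x) - 1. vec y)"
    using hahn_act_B[OF assms(1) x\<^sub>0 cube_vec[OF x]] half_casimir_cube[OF assms(1) x]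
    by (simp only: assms(2))
qed

end
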